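(* Let $\Sigma$ be a finite alphabet and let $W\in\Sigma^\infty$ be a computable infinite word such that every word in $\Sigma^*$ is a factor of $W$. Then the monadic second-order theory $\mathrm{MT}(\mathbb{N},<,W)$ is decidable.
   Context: An infinite word over $\Sigma$ is a sequence $W=w_1w_2\ldots w_n\ldots$ of symbols of $\Sigma$; it is computable if $n\mapsto w_n$ is computable. A factor of $W$ is a finite word of the form $w_nw_{n+1}\ldots w_m$ (the empty word is also regarded as a factor). $\mathrm{MT}(\mathbb{N},<,W)$ is the monadic second-order theory (first-order quantification over numbers and second-order quantification over unary predicates) of the structure consisting of the natural numbers (indexing the positions of $W$) with the standard order $<$ and, for each symbol $a\in\Sigma$, a unary predicate $a(n)$ that is true iff $w_n=a$. The theory is decidable if there is an algorithm that decides, given a monadic second-order sentence in this signature, whether it is true in this structure. *)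

theory Defs
  imports "HOL-Library.Nat_Bijection"
begin

text \<open>
  Computability is understood in the sense of partial recursive functions. A program has no
  built-in arity: on argument lists of a fixed length it denotes a partial recursive function.
\<close>

datatype recf =
    Zero
  | Succ
  | Proj nat
  | Comp recf "recf list"
  | PrimRec recf recf
  | Mu recf

text \<open>
  \<open>evaluates p xs y\<close>: on input \<open>xs\<close> the program \<open>p\<close> halts with output \<open>y\<close>. The recursion
  variable of \<open>PrimRec\<close> and the search variable of \<open>Mu\<close> come first in the argument list;
  \<open>Mu f\<close> requires \<open>f\<close> to halt with a nonzero value on all arguments below the returned one.
\<close>

inductive evaluates :: "recf \<Rightarrow> nat list \<Rightarrow> nat \<Rightarrow> bool" where
  zero: "evaluates Zero xs 0"
| succ: "evaluates Succ [x] (Suc x)"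
| proj: "i < length xs \<Longrightarrow> evaluates (Proj i) xs (xs ! i)"
| comp: "list_all2 (\<lambda>g y. evaluates g xs y) gs ys \<Longrightarrow> evaluates f ys z \<Longrightarrow>
    evaluates (Comp f gs) xs z"
| primrec_0: "evaluates f xs y \<Longrightarrow> evaluates (PrimRec f g) (0 # xs) y"
| primrec_Suc: "evaluates (PrimRec f g) (n # xs) y \<Longrightarrow> evaluates g (n # y # xs) z \<Longrightarrow>
    evaluates (PrimRec f g) (Suc n # xs) z"
| mu: "\<forall>i<n. \<exists>y. evaluates f (i # xs) (Suc y) \<Longrightarrow> evaluates f (n # xs) 0 \<Longrightarrow>
    evaluates (Mu f) xs n"

inductive_cases evaluates_ZeroE: "evaluates Zero xs y"
inductive_cases evaluates_SuccE: "evaluates Succ xs y"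
inductive_cases evaluates_ProjE: "evaluates (Proj i) xs y"
inductive_cases evaluates_CompE: "evaluates (Comp f gs) xs y"
inductive_cases evaluates_PrimRec_0E: "evaluates (PrimRec f g) (0 # xs) y"
inductive_cases evaluates_PrimRec_SucE: "evaluates (PrimRec f g) (Suc n # xs) y"
inductive_cases evaluates_MuE: "evaluates (Mu f) xs y"

lemma evaluates_deterministic: "evaluates p xs y \<Longrightarrow> evaluates p xs z \<Longrightarrow> y = z"
proof (induction arbitrary: z rule: evaluates.induct)
  case (zero xs)
  then show ?case by (rule evaluates_ZeroE) simp
next
  case (succ x)
  then show ?case by (rule evaluates_SuccE) simp
next
  case (proj i xs)
  from proj.prems show ?case by (rule evaluates_ProjE) simp
next
  case (comp xs gs ys f w)
  from comp.prems obtain ys' where ys': "list_all2 (\<lambda>g y. evaluates g xs y) gs ys'"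
    and f: "evaluates f ys' z"
    by (rule evaluates_CompE)
  have "ys = ys'"
  proof (rule nth_equalityI)
    show "length ys = length ys'"
      using list_all2_lengthD[OF comp.IH(1)] list_all2_lengthD[OF ys'] by simp
    show "ys ! i = ys' ! i" if "i < length ys" for i
    proof -
      have "evaluates (gs ! i) xs (ys' ! i)"
        using list_all2_nthD2[OF ys', of i] that \<open>length ys = length ys'\<close> by simp
      moreover have "\<forall>z. evaluates (gs ! i) xs z \<longrightarrow> ys ! i = z"
        using list_all2_nthD2[OF comp.IH(1) that] by (rule conjunct2)
      ultimately show ?thesis by blast
    qed
  qed
  with f have "evaluates f ys z" by simp
  then show ?case by (rule comp.IH(2))
next
  case (primrec_0 f xs y g)
  from primrec_0.prems have "evaluates f xs z" by (rule evaluates_PrimRec_0E)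
  then show ?case by (rule primrec_0.IH)
next
  case (primrec_Suc f g n xs y w)
  from primrec_Suc.prems obtain y' where y': "evaluates (PrimRec f g) (n # xs) y'"
    and g: "evaluates g (n # y' # xs) z"
    by (rule evaluates_PrimRec_SucE)
  from y' have "y = y'" by (rule primrec_Suc.IH(1))
  with g have "evaluates g (n # y # xs) z" by simp
  then show ?case by (rule primrec_Suc.IH(2))
next
  case (mu n f xs)
  from mu.prems have below: "\<forall>i<z. \<exists>y. evaluates f (i # xs) (Suc y)"
    by (rule evaluates_MuE)
  from mu.prems have at: "evaluates f (z # xs) 0"
    by (rule evaluates_MuE)
  have "\<not> z < n"
  proof
    assume "z < n"
    with mu.IH(1) obtain y where "\<forall>w. evaluates f (z # xs) w \<longrightarrow> Suc y = w" by blast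
    with at show False by blast
  qed
  moreover have "\<not> n < z"
  proof
    assume "n < z"
    with below obtain y where "evaluates f (n # xs) (Suc y)" by blast
    from mu.IH(2)[OF this] show False by simp
  qed
  ultimately show ?case by simp
qed

definition computable :: "(nat \<Rightarrow> nat) \<Rightarrow> bool" where
  "computable f \<longleftrightarrow> (\<exists>p. \<forall>n. evaluates p [n] (f n))"


text \<open>
  An alphabet is a finite type and an infinite word a function on \<open>nat\<close>, so positions are
  counted from 0. Symbols enter computations through a numbering \<open>c\<close> of the alphabet. As the
  alphabet is finite, any two numberings are recursively interchangeable; we accept any
  numbering for the computability of a word, and decidability is demanded for all of them.
\<close>

definition computable_word :: "(nat \<Rightarrow> 'a::finite) \<Rightarrow> bool" where
  "computable_word W \<longleftrightarrow> (\<exists>c :: 'a \<Rightarrow> nat. inj c \<and> computable (\<lambda>n. c (W n)))"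

definition factor :: "'a list \<Rightarrow> (nat \<Rightarrow> 'a) \<Rightarrow> bool" where
  "factor u W \<longleftrightarrow> u = [] \<or> (\<exists>n m. n \<le> m \<and> u = map W [n..<Suc m])"


text \<open>
  Formulas of monadic second-order logic over \<open><\<close> and the unary predicates \<open>a\<close>. First-order and
  set variables are two separate families of variables, each named by natural numbers; the
  remaining connectives and the universal quantifiers are the usual abbreviations.
\<close>

datatype 'a mso =
    Less nat nat
  | Equal nat nat
  | Symbol 'a nat
  | Member nat nat  \<comment> \<open>first-order variable, set variable\<close>
  | Neg "'a mso"
  | Conj "'a mso" "'a mso"
  | Ex1 nat "'a mso"
  | Ex2 nat "'a mso"

primrec free1 :: "'a mso \<Rightarrow> nat set" where
  "free1 (Less x y) = {x, y}"
| "free1 (Equal x y) = {x, y}"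
| "free1 (Symbol a x) = {x}"
| "free1 (Member x X) = {x}"
| "free1 (Neg \<phi>) = free1 \<phi>"
| "free1 (Conj \<phi> \<psi>) = free1 \<phi> \<union> free1 \<psi>"
| "free1 (Ex1 x \<phi>) = free1 \<phi> - {x}"
| "free1 (Ex2 X \<phi>) = free1 \<phi>"

primrec free2 :: "'a mso \<Rightarrow> nat set" where
  "free2 (Less x y) = {}"
| "free2 (Equal x y) = {}"
| "free2 (Symbol a x) = {}"
| "free2 (Member x X) = {X}"
| "free2 (Neg \<phi>) = free2 \<phi>"
| "free2 (Conj \<phi> \<psi>) = free2 \<phi> \<union> free2 \<psi>"
| "free2 (Ex1 x \<phi>) = free2 \<phi>"
| "free2 (Ex2 X \<phi>) = free2 \<phi> - {X}"

definition sentence :: "'a mso \<Rightarrow> bool" where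
  "sentence \<phi> \<longleftrightarrow> free1 \<phi> = {} \<and> free2 \<phi> = {}"

primrec sat :: "(nat \<Rightarrow> 'a) \<Rightarrow> (nat \<Rightarrow> nat) \<Rightarrow> (nat \<Rightarrow> nat set) \<Rightarrow> 'a mso \<Rightarrow> bool" where
  "sat W e E (Less x y) \<longleftrightarrow> e x < e y"
| "sat W e E (Equal x y) \<longleftrightarrow> e x = e y"
| "sat W e E (Symbol a x) \<longleftrightarrow> W (e x) = a"
| "sat W e E (Member x X) \<longleftrightarrow> e x \<in> E X"
| "sat W e E (Neg \<phi>) \<longleftrightarrow> \<not> sat W e E \<phi>"
| "sat W e E (Conj \<phi> \<psi>) \<longleftrightarrow> sat W e E \<phi> \<and> sat W e E \<psi>"
| "sat W e E (Ex1 x \<phi>) \<longleftrightarrow> (\<exists>n. sat W (e(x := n)) E \<phi>)"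
| "sat W e E (Ex2 X \<phi>) \<longleftrightarrow> (\<exists>A. sat W e (E(X := A)) \<phi>)"

definition MT :: "(nat \<Rightarrow> 'a) \<Rightarrow> 'a mso set" where
  "MT W = {\<phi>. sentence \<phi> \<and> (\<forall>e E. sat W e E \<phi>)}"

primrec code :: "('a \<Rightarrow> nat) \<Rightarrow> 'a mso \<Rightarrow> nat" where
  "code c (Less x y) = prod_encode (0, prod_encode (x, y))"
| "code c (Equal x y) = prod_encode (1, prod_encode (x, y))"
| "code c (Symbol a x) = prod_encode (2, prod_encode (c a, x))"
| "code c (Member x X) = prod_encode (3, prod_encode (x, X))"
| "code c (Neg \<phi>) = prod_encode (4, code c \<phi>)"
| "code c (Conj \<phi> \<psi>) = prod_encode (5, prod_encode (code c \<phi>, code c \<psi>))"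
| "code c (Ex1 x \<phi>) = prod_encode (6, prod_encode (x, code c \<phi>))"
| "code c (Ex2 X \<phi>) = prod_encode (7, prod_encode (X, code c \<phi>))"

lemma code_eq_iff:
  assumes "inj c"
  shows "code c \<phi> = code c \<psi> \<longleftrightarrow> \<phi> = \<psi>"
proof (induction \<phi> arbitrary: \<psi>)
  case (Symbol a x)
  then show ?case by (cases \<psi>) (simp_all add: inj_eq[OF assms])
next
  case (Less x y)
  then show ?case by (cases \<psi>) simp_all
next
  case (Equal x y)
  then show ?case by (cases \<psi>) simp_all
next
  case (Member x X)
  then show ?case by (cases \<psi>) simp_all
next
  case (Neg \<phi>)
  then show ?case by (cases \<psi>) simp_all
next
  case (Conj \<phi>1 \<phi>2)
  then show ?case by (cases \<psi>) simp_all
next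
  case (Ex1 x \<phi>)
  then show ?case by (cases \<psi>) simp_all
next
  case (Ex2 X \<phi>)
  then show ?case by (cases \<psi>) simp_all
qed

definition decidable_theory :: "'a::finite mso set \<Rightarrow> bool" where
  "decidable_theory T \<longleftrightarrow> (\<forall>c :: 'a \<Rightarrow> nat. inj c \<longrightarrow>
     (\<exists>p. \<forall>\<phi>. sentence \<phi> \<longrightarrow> evaluates p [code c \<phi>] (if \<phi> \<in> T then 1 else 0)))"

end

theory Submission
  imports Defs "HOL-Library.Ramsey"
begin

text \<open>
  Every formula is turned, computably in its code, into a finite algebra whose elements are types
  of finite words and which decides satisfaction for every infinite word from a Ramsey
  factorization \<open>s e e e \<dots>\<close>; existential quantification is the powerset construction. If \<open>W\<close>
  contains every finite word, the type \<open>e\<close> of its factorizations lies in the minimal ideal of the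
  finite semigroup of types. All pairs \<open>(s, e)\<close> with \<open>e\<close> an idempotent of the minimal ideal and
  \<open>s = s e\<close> the type of a prefix of \<open>W\<close> are conjugate, hence give the same answer, and such a pair
  together with a proof of its minimality is found by searching through the factors of \<open>W\<close>.
\<close>

section \<open>Closure properties of the computable functions\<close>

text \<open>Ramsey's theorem yields a factorization of \<open>W\<close> without a way to compute it.
  The procedure never finds one: it needs only a pair whose table entry agrees with that of a
  genuine factorization, and minimality of \<open>e\<close> is a finite statement once all types of
  finite words are known. These types are the closure of the types of single letters under appending
  letters, so a finite search can recognize that it has seen them all.

  The acceptance table obeys no algebraic law; it is only required to be correct for every
  factorization of every infinite word. Conjugate pairs get equal entries because one infinite word,
  in general different from \<open>W\<close>, admits both factorizations. For the same reason
  negation merely flips the table. Associativity is not imposed either: it holds for the types of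
  actual words, and the semigroup arguments stay among those.\<close>

definition left :: "nat \<Rightarrow> nat" where
  "left z = fst (prod_decode z)"

definition right :: "nat \<Rightarrow> nat" where
  "right z = snd (prod_decode z)"

lemma left_prod_encode [simp]: "left (prod_encode (a, b)) = a"
  and right_prod_encode [simp]: "right (prod_encode (a, b)) = b"
  by (simp_all add: left_def right_def)

lemma prod_encode_left_right [simp]: "prod_encode (left z, right z) = z"
  by (simp add: left_def right_def)

definition decidable :: "(nat \<Rightarrow> bool) \<Rightarrow> bool" where
  "decidable P \<longleftrightarrow> computable (\<lambda>x. of_bool (P x))"

named_theorems computable_intros

section \<open>Programs for arithmetic, pairing and unpairing\<close>

lemma evaluates_ProjI: "i < length xs \<Longrightarrow> y = xs ! i \<Longrightarrow> evaluates (Proj i) xs y"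
  using evaluates.proj by simp

lemma evaluates_Comp1: "evaluates g xs y \<Longrightarrow> evaluates f [y] z \<Longrightarrow> evaluates (Comp f [g]) xs z"
  by (rule evaluates.comp[of _ _ "[y]"]) simp_all

lemma evaluates_Comp2:
  "evaluates g xs y \<Longrightarrow> evaluates h xs y' \<Longrightarrow> evaluates f [y, y'] z \<Longrightarrow>
    evaluates (Comp f [g, h]) xs z"
  by (rule evaluates.comp[of _ _ "[y, y']"]) simp_all

definition add_prog :: recf where
  "add_prog = PrimRec (Proj 0) (Comp Succ [Proj 1])"

lemma evaluates_add: "evaluates add_prog [a, b] (a + b)"
proof (induction a)
  case 0
  show ?case unfolding add_prog_def by (auto intro!: evaluates.primrec_0 evaluates_ProjI)
next
  case (Suc a)
  then show ?case unfolding add_prog_def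
    by (auto intro!: evaluates_Comp1 evaluates.succ evaluates_ProjI
        elim!: evaluates.primrec_Suc)
qed

definition triangle_prog :: recf where
  "triangle_prog = PrimRec Zero (Comp add_prog [Proj 1, Comp Succ [Proj 0]])"

lemma evaluates_triangle: "evaluates triangle_prog [a] (triangle a)"
proof (induction a)
  case 0
  show ?case unfolding triangle_prog_def by (auto intro!: evaluates.intros)
next
  case (Suc a)
  have "evaluates (Comp add_prog [Proj 1, Comp Succ [Proj 0]]) [a, triangle a]
      (triangle a + Suc a)"
    by (rule evaluates_Comp2[OF evaluates_ProjI[OF _ refl]
          evaluates_Comp1[OF evaluates_ProjI[OF _ refl]] ])
       (use evaluates_add[of "triangle a" "Suc a"] in \<open>auto intro: evaluates.succ\<close>)
  then show ?case using Suc unfolding triangle_prog_def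
    by (auto elim!: evaluates.primrec_Suc)
qed

definition pair_prog :: recf where
  "pair_prog = Comp add_prog [Comp triangle_prog [add_prog], Proj 0]"

lemma evaluates_pair: "evaluates pair_prog [a, b] (prod_encode (a, b))"
  unfolding pair_prog_def prod_encode_def prod.case
  by (rule evaluates_Comp2[OF evaluates_Comp1[OF evaluates_add evaluates_triangle]
        evaluates_ProjI[OF _ refl]]) (auto intro: evaluates_add)

text \<open>Recursion runs over the first argument, so the subtrahend comes first. The inner
  \<open>PrimRec Zero (Proj 0)\<close> is the predecessor function.\<close>

definition sub_prog :: recf where
  "sub_prog = PrimRec (Proj 0)
     (Comp (Comp (PrimRec Zero (Proj 0)) [Proj 0]) [Proj 1])"

lemma evaluates_sub: "evaluates sub_prog [b, a] (a - b)"
proof (induction b)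
  case 0
  show ?case unfolding sub_prog_def by (auto intro!: evaluates.primrec_0 evaluates_ProjI)
next
  case (Suc b)
  have pred: "evaluates (PrimRec Zero (Proj 0)) [n] (n - 1)" for n
    by (induction n) (auto intro!: evaluates.primrec_0 evaluates.zero evaluates_ProjI
        elim!: evaluates.primrec_Suc)
  have "evaluates (Comp (Comp (PrimRec Zero (Proj 0)) [Proj 0]) [Proj 1]) [b, a - b, a] (a - b - 1)"
    by (rule evaluates_Comp1[OF evaluates_ProjI[OF _ refl]
          evaluates_Comp1[OF evaluates_ProjI[OF _ refl]]]) (use pred[of "a - b"] in auto)
  then show ?case using Suc unfolding sub_prog_def
    by (auto elim!: evaluates.primrec_Suc)
qed

lemma triangle_mono: "a \<le> b \<Longrightarrow> triangle a \<le> triangle b"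
  by (induction rule: dec_induct) auto

text \<open>\<open>left z + right z\<close> is the least \<open>w\<close> with \<open>z < triangle (Suc w)\<close>.\<close>

definition diagonal_prog :: recf where
  "diagonal_prog = Mu (Comp sub_prog
     [Comp triangle_prog [Comp Succ [Proj 0]], Comp Succ [Proj 1]])"

lemma evaluates_diagonal: "evaluates diagonal_prog [z] (left z + right z)"
proof -
  let ?f = "Comp sub_prog [Comp triangle_prog [Comp Succ [Proj 0]], Comp Succ [Proj 1]]"
  have f: "evaluates ?f [w, z] (Suc z - triangle (Suc w))" for w
    by (rule evaluates_Comp2[OF evaluates_Comp1[OF evaluates_Comp1[OF evaluates_ProjI[OF _ refl]]]
          evaluates_Comp1[OF evaluates_ProjI[OF _ refl]]])
       (auto intro: evaluates.succ evaluates_triangle evaluates_sub simp del: triangle_Suc)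
  have z: "z = triangle (left z + right z) + left z"
    using prod_encode_left_right[of z] unfolding prod_encode_def by simp
  have "\<exists>y. Suc z - triangle (Suc w) = Suc y" if "w < left z + right z" for w
  proof -
    have "triangle (Suc w) \<le> triangle (left z + right z)"
      using that by (intro triangle_mono) auto
    then have "triangle (Suc w) \<le> z" using z by linarith
    then show ?thesis by (auto simp: Suc_diff_le simp del: triangle_Suc)
  qed
  then have "\<forall>w<left z + right z. \<exists>y. evaluates ?f [w, z] (Suc y)"
    using f by metis
  moreover have "evaluates ?f [left z + right z, z] 0"
    using f[of "left z + right z"] z by simp
  ultimately show ?thesis
    unfolding diagonal_prog_def by (intro evaluates.mu)
qed

text \<open>\<open>prod_encode (a, b)\<close> is \<open>triangle (a + b) + a\<close>; removing the
  triangular number of the diagonal leaves \<open>a\<close>.\<close>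

definition left_prog :: recf where
  "left_prog = Comp sub_prog [Comp triangle_prog [diagonal_prog], Proj 0]"

lemma evaluates_left: "evaluates left_prog [z] (left z)"
proof -
  have "left z = z - triangle (left z + right z)"
    using prod_encode_left_right[of z] unfolding prod_encode_def by simp
  moreover have "evaluates left_prog [z] (z - triangle (left z + right z))"
    unfolding left_prog_def
    by (rule evaluates_Comp2[OF evaluates_Comp1[OF evaluates_diagonal evaluates_triangle]
          evaluates_ProjI[OF _ refl]]) (auto intro: evaluates_sub)
  ultimately show ?thesis by simp
qed

section \<open>Closure rules for unary computable functions\<close>

lemma computable_id [computable_intros]: "computable (\<lambda>x. x)"
  unfolding computable_def by (rule exI[of _ "Proj 0"]) (auto intro: evaluates_ProjI)

lemma computable_compose: "computable f \<Longrightarrow> computable g \<Longrightarrow> computable (\<lambda>x. f (g x))"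
  unfolding computable_def by (meson evaluates_Comp1)

lemma computable_Suc [computable_intros]: "computable f \<Longrightarrow> computable (\<lambda>x. Suc (f x))"
  by (rule computable_compose[of Suc]) (auto simp: computable_def intro: evaluates.succ)

lemma computable_const [computable_intros]: "computable (\<lambda>x. c)"
proof (induction c)
  case 0
  show ?case unfolding computable_def by (auto intro: evaluates.zero)
qed (rule computable_Suc)

lemma computable_binary:
  assumes "\<And>a b. evaluates p [a, b] (f a b)" "computable g" "computable h"
  shows "computable (\<lambda>x. f (g x) (h x))"
  using assms unfolding computable_def by (meson evaluates_Comp2)

lemma computable_prod_encode [computable_intros]:
  "computable f \<Longrightarrow> computable g \<Longrightarrow> computable (\<lambda>x. prod_encode (f x, g x))"
  by (rule computable_binary[OF evaluates_pair])

lemma computable_add [computable_intros]: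
  "computable f \<Longrightarrow> computable g \<Longrightarrow> computable (\<lambda>x. f x + g x)"
  by (rule computable_binary[OF evaluates_add])

lemma computable_diff [computable_intros]:
  "computable f \<Longrightarrow> computable g \<Longrightarrow> computable (\<lambda>x. f x - g x)"
  by (rule computable_binary[OF evaluates_sub])

lemma computable_left [computable_intros]: "computable f \<Longrightarrow> computable (\<lambda>x. left (f x))"
  by (rule computable_compose[of left]) (auto simp: computable_def intro: evaluates_left)

lemma computable_right [computable_intros]:
  assumes "computable f"
  shows "computable (\<lambda>x. right (f x))"
proof -
  have "computable (\<lambda>z. left z + right z)"
    unfolding computable_def using evaluates_diagonal by blast
  then have "computable (\<lambda>z. (left z + right z) - left z)"
    by (rule computable_diff) (rule computable_left[OF computable_id])
  then have "computable right" by simp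
  then show ?thesis using assms by (rule computable_compose)
qed

text \<open>\<open>computable\<close> speaks of unary functions only. A function with parameters is
  therefore presented through nested pairs, here of parameter, counter and previous value, and the
  program repacks its argument list \<open>[n, y, x]\<close> accordingly. Later closure rules for
  bound variables have the same form.\<close>

lemma computable_rec_nat [computable_intros]:
  assumes "computable a" "computable g"
    and "computable (\<lambda>z. h (left z) (left (right z)) (right (right z)))"
  shows "computable (\<lambda>x. rec_nat (g x) (h x) (a x))"
proof -
  from assms obtain pa pg ph where
    pa: "\<And>x. evaluates pa [x] (a x)" and pg: "\<And>x. evaluates pg [x] (g x)" and
    ph: "\<And>z. evaluates ph [z] (h (left z) (left (right z)) (right (right z)))"
    unfolding computable_def by metis
  let ?step = "Comp ph [Comp pair_prog [Proj 2, Comp pair_prog [Proj 0, Proj 1]]]"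
  have step: "evaluates ?step [n, y, x] (h x n y)" for n y x
  proof (rule evaluates_Comp1)
    show "evaluates (Comp pair_prog [Proj 2, Comp pair_prog [Proj 0, Proj 1]]) [n, y, x]
        (prod_encode (x, prod_encode (n, y)))"
      by (rule evaluates_Comp2[OF evaluates_ProjI[OF _ refl]
            evaluates_Comp2[OF evaluates_ProjI[OF _ refl] evaluates_ProjI[OF _ refl]]])
         (auto intro: evaluates_pair)
    show "evaluates ph [prod_encode (x, prod_encode (n, y))] (h x n y)"
      using ph[of "prod_encode (x, prod_encode (n, y))"] by simp
  qed
  have "evaluates (PrimRec pg ?step) [n, x] (rec_nat (g x) (h x) n)" for n x
    by (induction n) (use pg step in \<open>auto intro: evaluates.primrec_0 elim!: evaluates.primrec_Suc simp del: One_nat_def\<close>)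
  then have "\<forall>x. evaluates (Comp (PrimRec pg ?step) [pa, Proj 0]) [x] (rec_nat (g x) (h x) (a x))"
    by (auto intro!: evaluates_Comp2[OF pa] evaluates_ProjI)
  then show ?thesis unfolding computable_def by blast
qed

lemma computable_mult [computable_intros]:
  assumes "computable f" "computable g"
  shows "computable (\<lambda>x. f x * g x)"
proof -
  have "f x * g x = rec_nat 0 (\<lambda>_ y. y + g x) (f x)" for x
  proof -
    have "n * m = rec_nat 0 (\<lambda>_ y. y + m) n" for n m :: nat
      by (induction n) simp_all
    then show ?thesis .
  qed
  then show ?thesis
    by simp (intro computable_intros assms computable_compose[OF assms(2)])
qed


section \<open>Decidable predicates, bounded quantifiers and coded finite sets\<close>

lemma decidableI: "computable f \<Longrightarrow> (\<And>x. P x \<longleftrightarrow> f x \<noteq> 0) \<Longrightarrow> decidable P"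
proof -
  assume f: "computable f" and P: "\<And>x. P x \<longleftrightarrow> f x \<noteq> 0"
  have "computable (\<lambda>x. 1 - (1 - f x))"
    by (intro computable_intros f)
  moreover have "(\<lambda>x. 1 - (1 - f x)) = (\<lambda>x. of_bool (P x))"
    using P by auto
  ultimately show ?thesis by (simp add: decidable_def)
qed

lemma computable_of_bool [computable_intros]: "decidable P \<Longrightarrow> computable (\<lambda>x. of_bool (P x))"
  by (simp add: decidable_def)

lemma decidable_const [computable_intros]: "decidable (\<lambda>x. b)"
  unfolding decidable_def by (rule computable_const)

lemma decidable_Not [computable_intros]: "decidable P \<Longrightarrow> decidable (\<lambda>x. \<not> P x)"
  by (rule decidableI[where f = "\<lambda>x. 1 - of_bool (P x)"]) (auto intro!: computable_intros)

lemma decidable_conj [computable_intros]: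
  "decidable P \<Longrightarrow> decidable Q \<Longrightarrow> decidable (\<lambda>x. P x \<and> Q x)"
  by (rule decidableI[where f = "\<lambda>x. of_bool (P x) * of_bool (Q x)"])
     (auto intro!: computable_intros)

lemma decidable_disj [computable_intros]:
  "decidable P \<Longrightarrow> decidable Q \<Longrightarrow> decidable (\<lambda>x. P x \<or> Q x)"
  by (rule decidableI[where f = "\<lambda>x. of_bool (P x) + of_bool (Q x)"])
     (auto intro!: computable_intros)

lemma decidable_imp [computable_intros]:
  "decidable P \<Longrightarrow> decidable Q \<Longrightarrow> decidable (\<lambda>x. P x \<longrightarrow> Q x)"
  unfolding imp_conv_disj by (intro computable_intros)

lemma decidable_less [computable_intros]:
  "computable f \<Longrightarrow> computable g \<Longrightarrow> decidable (\<lambda>x. f x < g x)"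
  by (rule decidableI[where f = "\<lambda>x. g x - f x"]) (auto intro!: computable_intros)

lemma decidable_eq [computable_intros]:
  "computable f \<Longrightarrow> computable g \<Longrightarrow> decidable (\<lambda>x. f x = g x)"
  unfolding order_eq_iff not_less[symmetric] by (intro computable_intros)

lemma computable_if [computable_intros]:
  assumes "decidable P" "computable f" "computable g"
  shows "computable (\<lambda>x. if P x then f x else g x)"
proof -
  have "(\<lambda>x. if P x then f x else g x) = (\<lambda>x. of_bool (P x) * f x + of_bool (\<not> P x) * g x)"
    by auto
  moreover have "computable \<dots>"
    by (intro computable_intros assms)
  ultimately show ?thesis by simp
qed

lemma computable_power2 [computable_intros]:
  assumes "computable f"
  shows "computable (\<lambda>x. 2 ^ f x)"
proof -
  have "(2 :: nat) ^ n = rec_nat 1 (\<lambda>_ y. 2 * y) n" for n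
    by (induction n) simp_all
  then show ?thesis by simp (intro computable_intros assms)
qed

lemma computable_sum [computable_intros]:
  assumes "computable n" "computable (\<lambda>z. f (left z) (right z))"
  shows "computable (\<lambda>x. \<Sum>i<n x. f x i)"
proof -
  have "(\<Sum>i<k. f x i) = rec_nat 0 (\<lambda>i y. y + f x i) k" for x k
    by (induction k) simp_all
  moreover have "computable (\<lambda>z. f (left z) (left (right z)))"
    using computable_compose[OF assms(2), of "\<lambda>z. prod_encode (left z, left (right z))"]
    by (simp add: computable_intros)
  ultimately show ?thesis by simp (intro computable_intros assms)
qed

lemma decidable_bounded_ex [computable_intros]:
  assumes "computable n" "decidable (\<lambda>z. P (left z) (right z))"
  shows "decidable (\<lambda>x. \<exists>i<n x. P x i)"
  by (rule decidableI[where f = "\<lambda>x. \<Sum>i<n x. of_bool (P x i)"])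
     (intro computable_intros assms, auto)

lemma decidable_bounded_all [computable_intros]:
  assumes "computable n" "decidable (\<lambda>z. P (left z) (right z))"
  shows "decidable (\<lambda>x. \<forall>i<n x. P x i)"
proof -
  have "decidable (\<lambda>x. \<not> (\<exists>i<n x. \<not> P x i))"
    by (intro computable_intros assms)
  then show ?thesis by simp
qed

lemma computable_set_encode [computable_intros]:
  assumes "computable n" "decidable (\<lambda>z. P (left z) (right z))"
  shows "computable (\<lambda>x. set_encode {i. i < n x \<and> P x i})"
proof -
  have "set_encode {i. i < k \<and> P x i} = (\<Sum>i<k. if P x i then 2 ^ i else 0)" for x k
    unfolding set_encode_def
    by (subst sum.inter_filter[symmetric]) (auto intro!: sum.cong)
  then show ?thesis by simp (intro computable_intros assms)
qed

text \<open>Membership is a bit test. Halving is itself a recursion, because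
  \<open>Suc n div 2 = n - n div 2\<close>, and iterated halving gives division by powers of
  two.\<close>

lemma decidable_set_decode [computable_intros]:
  assumes "computable f" "computable g"
  shows "decidable (\<lambda>x. f x \<in> set_decode (g x))"
proof -
  have "n div 2 = rec_nat 0 (\<lambda>i y. i - y) n" for n :: nat
  proof (induction n)
    case (Suc n)
    have "Suc n div 2 = n - n div 2" by presburger
    then show ?case using Suc by simp
  qed simp
  then have div2: "computable (\<lambda>n. n div 2)"
    by simp (intro computable_intros)
  have "b div 2 ^ n = rec_nat b (\<lambda>_ y. y div 2) n" for b n :: nat
    by (induction n) (simp_all add: div_mult2_eq power_Suc2 del: power_Suc)
  then have div: "computable (\<lambda>x. g x div 2 ^ f x)"
    by simp (intro computable_intros computable_compose[OF div2] assms)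
  show ?thesis
  proof (rule decidableI)
    show "computable (\<lambda>x. (g x div 2 ^ f x) - 2 * ((g x div 2 ^ f x) div 2))"
      by (intro computable_intros div computable_compose[OF div2])
    show "f x \<in> set_decode (g x) \<longleftrightarrow> (g x div 2 ^ f x) - 2 * ((g x div 2 ^ f x) div 2) \<noteq> 0" for x
      by (simp add: set_decode_def minus_mult_div_eq_mod odd_iff_mod_2_eq_one)
  qed
qed

section \<open>Finite tables as nested pairs\<close>

definition tabulate :: "(nat \<Rightarrow> nat) \<Rightarrow> nat \<Rightarrow> nat" where
  "tabulate f n = rec_nat 0 (\<lambda>i t. prod_encode (f (n - Suc i), t)) n"

definition lookup :: "nat \<Rightarrow> nat \<Rightarrow> nat" where
  "lookup t i = left (rec_nat t (\<lambda>_ y. right y) i)"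

lemma lookup_prod_encode_0 [simp]: "lookup (prod_encode (a, t)) 0 = a"
  by (simp add: lookup_def)

lemma lookup_prod_encode_Suc [simp]: "lookup (prod_encode (a, t)) (Suc i) = lookup t i"
proof -
  have "rec_nat (prod_encode (a, t)) (\<lambda>_ y. right y) (Suc i) = rec_nat t (\<lambda>_ y. right y) i"
    by (induction i) simp_all
  then show ?thesis by (simp only: lookup_def)
qed

text \<open>Recursion prepends, so the table is filled from the last index downwards in order to
  have index 0 at its head. The induction follows the partial tables: after \<open>k\<close> rounds
  the head belongs to index \<open>n - k\<close>.\<close>

lemma lookup_tabulate [simp]:
  assumes "i < n"
  shows "lookup (tabulate f n) i = f i"
proof -
  have "lookup (rec_nat 0 (\<lambda>i t. prod_encode (f (n - Suc i), t)) k) i = f (n - k + i)"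
    if "i < k" "k \<le> n" for k i
    using that
  proof (induction k arbitrary: i)
    case (Suc k)
    then show ?case by (cases i) (auto simp: Suc_diff_Suc)
  qed simp
  from this[of i n] show ?thesis using assms by (simp add: tabulate_def)
qed

lemma computable_tabulate [computable_intros]:
  assumes "computable n" "computable (\<lambda>z. f (left z) (right z))"
  shows "computable (\<lambda>x. tabulate (f x) (n x))"
proof -
  have "computable (\<lambda>z. f (left z) (n (left z) - Suc (left (right z))))"
    using computable_compose[OF assms(2),
        of "\<lambda>z. prod_encode (left z, n (left z) - Suc (left (right z)))"]
    by (simp add: computable_intros computable_compose[OF assms(1)])
  then show ?thesis unfolding tabulate_def by (intro computable_intros assms)
qed

lemma computable_lookup [computable_intros]:
  "computable f \<Longrightarrow> computable g \<Longrightarrow> computable (\<lambda>x. lookup (f x) (g x))"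
  unfolding lookup_def by (intro computable_intros)

text \<open>Course-of-values recursion; the most recent value comes first.\<close>

definition history :: "(nat \<Rightarrow> nat \<Rightarrow> nat) \<Rightarrow> nat \<Rightarrow> nat" where
  "history g n = rec_nat 0 (\<lambda>i h. prod_encode (g i h, h)) n"

lemma lookup_history:
  "k < n \<Longrightarrow> lookup (history g n) (n - Suc k) = g k (history g k)"
proof (induction n)
  case (Suc n)
  show ?case
  proof (cases "k = n")
    case False
    with Suc.prems have "k < n" by simp
    then have "Suc n - Suc k = Suc (n - Suc k)" by simp
    with Suc.IH[OF \<open>k < n\<close>] show ?thesis by (simp add: history_def)
  qed (simp add: history_def)
qed simp

lemma computable_history [computable_intros]:
  assumes "computable n"
    and "computable (\<lambda>z. g (left z) (left (right z)) (right (right z)))"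
  shows "computable (\<lambda>x. history (g x) (n x))"
  unfolding history_def by (intro computable_intros assms)

text \<open>A function on a finite set is a finite case distinction, here on the value of
  \<open>d\<close>. This converts one numbering of the alphabet into another.\<close>

lemma computable_finite_function:
  assumes "finite A" "inj_on d A" "computable (\<lambda>n. d (w n))" "\<And>n. w n \<in> A"
  shows "computable (\<lambda>n. c (w n))"
proof -
  have "computable (\<lambda>n. \<Sum>a\<in>A. if d (w n) = d a then c a else 0)"
    using assms(1)
    by induction (auto intro!: computable_intros assms(3))
  moreover have "(\<Sum>a\<in>A. if d (w n) = d a then c a else 0) = c (w n)" for n
  proof -
    have "(\<Sum>a\<in>A. if d (w n) = d a then c a else 0) = (\<Sum>a\<in>A. if w n = a then c a else 0)"
      using assms(2,4) by (intro sum.cong refl if_cong) (auto dest: inj_onD)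
    then show ?thesis using assms(1,4) by simp
  qed
  ultimately show ?thesis by simp
qed

text \<open>One program has to serve every input, so \<open>p\<close> is chosen before
  \<open>x\<close> and \<open>v\<close>. \<open>Mu\<close> stops at the least witness, of which
  nothing more is known; hence the demand that all witnesses give the same value.\<close>

lemma evaluates_search:
  assumes "decidable (\<lambda>z. P (left z) (right z))"
    and "computable (\<lambda>z. f (left z) (right z))"
  shows "\<exists>p. \<forall>x v. (\<exists>z. P x z) \<longrightarrow> (\<forall>z. P x z \<longrightarrow> f x z = v) \<longrightarrow> evaluates p [x] v"
proof -
  have "computable (\<lambda>z. 1 - of_bool (P (left z) (right z)))"
    by (intro computable_intros assms)
  then obtain pP pf where
    pP: "\<And>z. evaluates pP [z] (1 - of_bool (P (left z) (right z)))" and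
    pf: "\<And>z. evaluates pf [z] (f (left z) (right z))"
    using assms(2) unfolding computable_def by blast
  \<comment> \<open>\<open>Mu\<close> puts the search variable first, whereas \<open>P\<close>
    expects it second; hence the swapped projections.\<close>
  let ?c = "Comp pP [Comp pair_prog [Proj 1, Proj 0]]"
  let ?p = "Comp pf [Comp pair_prog [Proj 0, Mu ?c]]"
  have c: "evaluates ?c [z, x] (1 - of_bool (P x z))" for z x
  proof (rule evaluates_Comp1)
    show "evaluates (Comp pair_prog [Proj 1, Proj 0]) [z, x] (prod_encode (x, z))"
      by (rule evaluates_Comp2[OF evaluates_ProjI[OF _ refl] evaluates_ProjI[OF _ refl]])
         (auto intro: evaluates_pair)
    show "evaluates pP [prod_encode (x, z)] (1 - of_bool (P x z))"
      using pP[of "prod_encode (x, z)"] by simp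
  qed
  have "evaluates ?p [x] v" if ex: "\<exists>z. P x z" and v: "\<And>z. P x z \<Longrightarrow> f x z = v" for x v
  proof -
    let ?z = "LEAST z. P x z"
    have Pz: "P x ?z" using ex by (rule LeastI_ex)
    have "evaluates (Mu ?c) [x] ?z"
    proof (rule evaluates.mu)
      show "evaluates ?c [?z, x] 0" using c[of ?z x] Pz by simp
      show "\<forall>i<?z. \<exists>y. evaluates ?c [i, x] (Suc y)"
        using c[of _ x] not_less_Least[of _ "P x"]
        by (metis (full_types) One_nat_def diff_zero of_bool_eq(1))
    qed
    then have "evaluates (Comp pair_prog [Proj 0, Mu ?c]) [x] (prod_encode (x, ?z))"
      by (rule evaluates_Comp2[OF _ _ evaluates_pair, rotated]) (simp add: evaluates_ProjI)
    then show ?thesis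
      using pf[of "prod_encode (x, ?z)"] v[OF Pz] by (auto intro: evaluates_Comp1)
  qed
  then show ?thesis by blast
qed

section \<open>Recognition of languages of infinite words by finite algebras\<close>

text \<open>Bounds the length of tables: an entry indexed by a pair with components below
  \<open>c\<close> and \<open>d\<close> has an index below
  \<open>prod_encode (c, d)\<close>.\<close>

lemma prod_encode_mono: "a < c \<Longrightarrow> b \<le> d \<Longrightarrow> prod_encode (a, b) < prod_encode (c, d)"
  using triangle_mono[of "a + b" "c + d"] by (simp add: prod_encode_def)

lemma set_encode_less:
  assumes "A \<subseteq> {..<m}"
  shows "set_encode A < 2 ^ m"
proof -
  have "set_encode A \<le> set_encode {..<m}"
    using assms finite_subset[OF assms] by (intro subset_decode_imp_le) simp
  also have "\<dots> < 2 ^ m"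
    by (induction m) (simp_all add: lessThan_Suc)
  finally show ?thesis .
qed

text \<open>
  A letter carries a symbol number and the set of tracks marked at its position. Track \<open>2 * x\<close>
  belongs to the first-order variable \<open>x\<close>, track \<open>2 * X + 1\<close> to the set variable \<open>X\<close>.
\<close>

type_synonym letter = "nat \<times> nat set"

definition letters :: "nat \<Rightarrow> nat \<Rightarrow> letter set" where
  "letters q N = {(s, B). s < q \<and> B \<subseteq> {..<N}}"

lemma mem_letters_iff: "a \<in> letters q N \<longleftrightarrow> fst a < q \<and> snd a \<subseteq> {..<N}"
  by (cases a) (simp add: letters_def)

definition code_letter :: "letter \<Rightarrow> nat" where
  "code_letter a = prod_encode (fst a, set_encode (snd a))"

lemma code_letter_less: "a \<in> letters q N \<Longrightarrow> code_letter a < prod_encode (q, 2 ^ N)"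
  unfolding letters_def code_letter_def
  by (auto intro!: prod_encode_mono less_imp_le[OF set_encode_less])

lemma left_code_letter [simp]: "left (code_letter a) = fst a"
  by (simp add: code_letter_def)

lemma set_decode_right_code_letter [simp]:
  "a \<in> letters q N \<Longrightarrow> set_decode (right (code_letter a)) = snd a"
  by (auto simp: code_letter_def letters_def finite_subset)

text \<open>The whole algebra is one number, so that it can be a value of a computable recursion.
  The components are size, product table, letter table and acceptance table. Infinite products are
  not stored; the pair \<open>(s, e)\<close> stands for \<open>s e e e ...\<close>.\<close>

definition algebra :: "nat \<Rightarrow> nat \<Rightarrow> nat \<Rightarrow> (nat \<Rightarrow> nat \<Rightarrow> nat) \<Rightarrow> (nat \<Rightarrow> nat) \<Rightarrow>
    (nat \<Rightarrow> nat \<Rightarrow> bool) \<Rightarrow> nat" where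
  "algebra q N m f g P = prod_encode (m,
     prod_encode (tabulate (\<lambda>z. f (left z) (right z)) (prod_encode (m, m)),
     prod_encode (tabulate g (prod_encode (q, 2 ^ N)),
       tabulate (\<lambda>z. of_bool (P (left z) (right z))) (prod_encode (m, m)))))"

definition alg_size :: "nat \<Rightarrow> nat" where
  "alg_size A = left A"

definition alg_mult :: "nat \<Rightarrow> nat \<Rightarrow> nat \<Rightarrow> nat" where
  "alg_mult A a b = lookup (left (right A)) (prod_encode (a, b))"

definition alg_letter :: "nat \<Rightarrow> nat \<Rightarrow> nat" where
  "alg_letter A l = lookup (left (right (right A))) l"

definition alg_accept :: "nat \<Rightarrow> nat \<Rightarrow> nat \<Rightarrow> bool" where
  "alg_accept A s e \<longleftrightarrow> lookup (right (right (right A))) (prod_encode (s, e)) \<noteq> 0"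

lemma alg_size_algebra [simp]: "alg_size (algebra q N m f g P) = m"
  by (simp add: alg_size_def algebra_def)

lemma alg_mult_algebra [simp]:
  "a < m \<Longrightarrow> b < m \<Longrightarrow> alg_mult (algebra q N m f g P) a b = f a b"
  by (simp add: alg_mult_def algebra_def prod_encode_mono)

lemma alg_letter_algebra [simp]:
  "a \<in> letters q N \<Longrightarrow> alg_letter (algebra q N m f g P) (code_letter a) = g (code_letter a)"
  by (simp add: alg_letter_def algebra_def code_letter_less)

lemma alg_accept_algebra [simp]:
  "a < m \<Longrightarrow> b < m \<Longrightarrow> alg_accept (algebra q N m f g P) a b \<longleftrightarrow> P a b"
  by (simp add: alg_accept_def algebra_def prod_encode_mono)

text \<open>A Ramsey factorization of \<open>x\<close> at the cut points \<open>p\<close>.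
  Quantifying over all prefixes and all pairs of cut points expresses \<open>s e = s\<close> and
  \<open>e e = e\<close> without reference to an algebra; \<open>0 < p 0\<close> keeps the prefix
  nonempty.\<close>

definition linked :: "('a list \<Rightarrow> nat) \<Rightarrow> (nat \<Rightarrow> 'a) \<Rightarrow> (nat \<Rightarrow> nat) \<Rightarrow> nat \<Rightarrow> nat \<Rightarrow> bool" where
  "linked \<tau> x p s e \<longleftrightarrow> strict_mono p \<and> 0 < p 0 \<and>
     (\<forall>j. \<tau> (map x [0..<p j]) = s) \<and> (\<forall>i j. i < j \<longrightarrow> \<tau> (map x [p i..<p j]) = e)"

text \<open>A homomorphism from the free semigroup of nonempty words, so that no unit has to be
  carried along.\<close>

definition typing :: "nat \<Rightarrow> nat \<Rightarrow> nat \<Rightarrow> (letter list \<Rightarrow> nat) \<Rightarrow> bool" where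
  "typing q N A \<tau> \<longleftrightarrow>
     (\<forall>u. u \<noteq> [] \<longrightarrow> set u \<subseteq> letters q N \<longrightarrow> \<tau> u < alg_size A) \<and>
     (\<forall>a \<in> letters q N. \<tau> [a] = alg_letter A (code_letter a)) \<and>
     (\<forall>u v. u \<noteq> [] \<longrightarrow> v \<noteq> [] \<longrightarrow> set u \<subseteq> letters q N \<longrightarrow> set v \<subseteq> letters q N \<longrightarrow>
        \<tau> (u @ v) = alg_mult A (\<tau> u) (\<tau> v))"

text \<open>Correctness is demanded for every factorization of a word. Two pairs realized by the
  same word are thereby forced to have the same table entry.\<close>

definition recognizes :: "nat \<Rightarrow> nat \<Rightarrow> nat \<Rightarrow> ((nat \<Rightarrow> letter) \<Rightarrow> bool) \<Rightarrow> bool" where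
  "recognizes q N A L \<longleftrightarrow> (\<exists>\<tau>. typing q N A \<tau> \<and>
     (\<forall>x p s e. range x \<subseteq> letters q N \<longrightarrow> linked \<tau> x p s e \<longrightarrow> (alg_accept A s e \<longleftrightarrow> L x)))"

section \<open>Types of segments and linked factorizations\<close>

lemma typing_less: "typing q N A \<tau> \<Longrightarrow> u \<noteq> [] \<Longrightarrow> set u \<subseteq> letters q N \<Longrightarrow> \<tau> u < alg_size A"
  and typing_letter: "typing q N A \<tau> \<Longrightarrow> a \<in> letters q N \<Longrightarrow> \<tau> [a] = alg_letter A (code_letter a)"
  and typing_append: "typing q N A \<tau> \<Longrightarrow> u \<noteq> [] \<Longrightarrow> v \<noteq> [] \<Longrightarrow> set u \<subseteq> letters q N \<Longrightarrow>
    set v \<subseteq> letters q N \<Longrightarrow> \<tau> (u @ v) = alg_mult A (\<tau> u) (\<tau> v)"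
  by (simp_all add: typing_def)

lemma map_upt_append: "i \<le> j \<Longrightarrow> j \<le> k \<Longrightarrow> map x [i..<j] @ map x [j..<k] = map x [i..<k]"
  by (metis le_Suc_ex map_append upt_add_eq_append)

lemma set_segment_subset: "range x \<subseteq> S \<Longrightarrow> set (map x [i..<j]) \<subseteq> S"
  unfolding set_map by (meson image_mono subset_UNIV order_trans)

lemma typing_segment_less:
  assumes "typing q N A \<tau>" "range x \<subseteq> letters q N" "i < j"
  shows "\<tau> (map x [i..<j]) < alg_size A"
  using assms(3) by (intro typing_less[OF assms(1)] set_segment_subset[OF assms(2)]) simp

lemma typing_segment_append:
  assumes "typing q N A \<tau>" "range x \<subseteq> letters q N" "i < j" "j < k"
  shows "\<tau> (map x [i..<k]) = alg_mult A (\<tau> (map x [i..<j])) (\<tau> (map x [j..<k]))"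
  using typing_append[OF assms(1) _ _ set_segment_subset[OF assms(2)]
      set_segment_subset[OF assms(2)], of i j j k] assms(3,4)
  by (simp add: map_upt_append)

lemma linked_less:
  assumes "typing q N A \<tau>" "range x \<subseteq> letters q N" "linked \<tau> x p s e"
  shows "s < alg_size A" "e < alg_size A"
proof -
  have p: "p 0 < p 1" using assms(3) by (simp add: linked_def strict_mono_less)
  have "s = \<tau> (map x [0..<p 0])" "e = \<tau> (map x [p 0..<p 1])" "0 < p 0"
    using assms(3) by (auto simp: linked_def)
  then show "s < alg_size A" "e < alg_size A"
    using p by (simp_all add: typing_segment_less[OF assms(1,2)])
qed

lemma linked_idempotent:
  assumes "typing q N A \<tau>" "range x \<subseteq> letters q N" "linked \<tau> x p s e"
  shows "alg_mult A e e = e" "alg_mult A s e = s"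
proof -
  have p: "0 < p 0" "p 0 < p 1" "p 1 < p 2"
    using assms(3) by (simp_all add: linked_def strict_mono_less)
  show "alg_mult A e e = e"
    using typing_segment_append[OF assms(1,2) p(2,3)] assms(3) by (simp add: linked_def)
  show "alg_mult A s e = s"
    using typing_segment_append[OF assms(1,2) p(1,2)] assms(3) by (simp add: linked_def)
qed

text \<open>The two equations absorb any further copy of \<open>e\<close>, so the first prefix and
  consecutive segments determine all the others by induction.\<close>

lemma linkedI:
  assumes "typing q N A \<tau>" "range x \<subseteq> letters q N" "strict_mono p" "0 < p 0"
    and "\<tau> (map x [0..<p 0]) = s" "\<And>i. \<tau> (map x [p i..<p (Suc i)]) = e"
    and "alg_mult A e e = e" "alg_mult A s e = s"
  shows "linked \<tau> x p s e"
proof -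
  have less: "p i < p j" if "i < j" for i j
    using assms(3) that by (simp add: strict_mono_less)
  have "\<tau> (map x [0..<p j]) = s" for j
  proof (induction j)
    case (Suc j)
    have "0 < p j" using assms(4) less[of 0 j] by (cases "j = 0") auto
    with typing_segment_append[OF assms(1,2) this less[of j "Suc j"]] Suc show ?case
      by (simp add: assms(6,8))
  qed (simp add: assms(5))
  moreover have "\<tau> (map x [p i..<p (Suc (i + j))]) = e" for i j
  proof (induction j)
    case (Suc j)
    with typing_segment_append[OF assms(1,2) less[of i "Suc (i + j)"]
        less[of "Suc (i + j)" "Suc (i + Suc j)"]] show ?case
      by (simp add: assms(6,7))
  qed (simp add: assms(6))
  ultimately show ?thesis
    unfolding linked_def using assms(3,4) by (auto dest!: less_imp_Suc_add)
qed

text \<open>Ramsey's theorem, applied to the types of the segments between the given cut points.\<close>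

lemma linked_subsequence_exists:
  fixes p :: "nat \<Rightarrow> nat"
  assumes "typing q N A \<tau>" "range x \<subseteq> letters q N" "strict_mono p"
  obtains r s e where "strict_mono r" "linked \<tau> x (p \<circ> r) s e"
proof -
  \<comment> \<open>Ramsey's theorem colours two-element sets; \<open>Min\<close> and
    \<open>Max\<close> recover the order of the two cut indices.\<close>
  define f where "f X = \<tau> (map x [p (Min X)..<p (Max X)])" for X :: "nat set"
  have f: "f {i, j} = \<tau> (map x [p i..<p j])" if "i < j" for i j
    using that by (simp add: f_def)
  have "f {i, j} < alg_size A" if "i < j" for i j
    unfolding f[OF that] using that assms(3)
    by (intro typing_segment_less[OF assms(1,2)]) (simp add: strict_mono_less)
  then have "\<forall>i\<in>UNIV. \<forall>j\<in>UNIV. i \<noteq> j \<longrightarrow> f {i, j} < alg_size A"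
    by (metis insert_commute nat_neq_iff)
  then obtain Y e where Y: "infinite Y" "\<forall>i\<in>Y. \<forall>j\<in>Y. i \<noteq> j \<longrightarrow> f {i, j} = e"
    using Ramsey2[of UNIV f "alg_size A"] by auto
  \<comment> \<open>Skipping the least element of \<open>Y\<close> gives \<open>0 < r 0\<close>,
    hence a nonempty prefix even if \<open>p 0 = 0\<close>.\<close>
  define r where "r i = enumerate Y (Suc i)" for i
  have mono: "strict_mono r"
    unfolding r_def strict_mono_def using Y(1) by (simp add: enumerate_mono)
  have "0 < r 0" 
    unfolding r_def by (rule le_less_trans[OF le0 enumerate_mono[OF lessI Y(1)]])
  have rY: "r i \<in> Y" for i unfolding r_def using Y(1) by (rule enumerate_in_set)
  have e: "\<tau> (map x [p (r i)..<p (r j)]) = e" if "i < j" for i j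
  proof -
    have "r i < r j" using mono that by (simp add: strict_mono_less)
    then show ?thesis using Y(2) rY f[of "r i" "r j"] by (metis nat_neq_iff)
  qed
  \<comment> \<open>The cut point \<open>p (r 0)\<close> is dropped: each later prefix is the one up
    to \<open>p (r 0)\<close> followed by a segment of type \<open>e\<close>, so all of them share
    one type.\<close>
  let ?p = "p \<circ> (r \<circ> Suc)"
  have mono': "strict_mono (r \<circ> Suc)" "strict_mono ?p"
    using mono assms(3) by (auto simp: strict_mono_def)
  have less: "0 < p (r 0)"  "p (r 0) < p (r 1)" "p (r 1) < p (r 2)"
  proof -
    show "0 < p (r 0)" using assms(3) \<open>0 < r 0\<close> by (metis gr0I not_less_zero strict_mono_less)
  qed (use assms(3) mono in \<open>simp_all add: strict_mono_less\<close>)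
  have ee: "alg_mult A e e = e"
    using typing_segment_append[OF assms(1,2) less(2,3)] e by simp
  let ?s = "\<tau> (map x [0..<p (r 1)])"
  have se: "\<tau> (map x [0..<p (r k)]) = \<tau> (map x [0..<p (r 1)])" if "1 \<le> k" for k
    using that
  proof (induction k rule: dec_induct)
    case (step k)
    have *: "p (r k) < p (r (Suc k))" "p (r 0) < p (r k)"
      using assms(3) mono step(1) by (simp_all add: strict_mono_less)
    have 1: "\<tau> (map x [0..<p (r (Suc k))]) = alg_mult A (\<tau> (map x [0..<p (r 0)])) e"
      using typing_segment_append[OF assms(1,2) less(1), of "p (r (Suc k))"] * e[of 0 "Suc k"]
      by simp
    have 2: "\<tau> (map x [0..<p (r k)]) = alg_mult A (\<tau> (map x [0..<p (r 0)])) e"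
      using typing_segment_append[OF assms(1,2) less(1), of "p (r k)"] * e[of 0 k] step(1)
      by simp
    show ?case using 1 2 step(3) by simp
  qed simp
  have "\<tau> (map x [0..<?p j]) = ?s" for j
    using se[of "Suc j"] by simp
  then have "linked \<tau> x ?p ?s e"
    unfolding linked_def using mono'(2) less e by (simp add: less_trans[OF less(1,2)])
  then show thesis using mono'(1) by (intro that[of "r \<circ> Suc"]) auto
qed

section \<open>Complement and intersection of recognized languages\<close>

definition neg_algebra :: "nat \<Rightarrow> nat \<Rightarrow> nat \<Rightarrow> nat" where
  "neg_algebra q N A = algebra q N (alg_size A) (alg_mult A) (alg_letter A)
     (\<lambda>s e. \<not> alg_accept A s e)"

text \<open>On a linked pair the table entry is equivalent to membership, not merely sufficient for
  it, so complementation needs no new states.\<close>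

lemma recognizes_not:
  assumes "recognizes q N A L"
  shows "recognizes q N (neg_algebra q N A) (\<lambda>x. \<not> L x)"
proof -
  from assms obtain \<tau> where \<tau>: "typing q N A \<tau>" and
    L: "\<And>x p s e. range x \<subseteq> letters q N \<Longrightarrow> linked \<tau> x p s e \<Longrightarrow> alg_accept A s e \<longleftrightarrow> L x"
    unfolding recognizes_def by blast
  show ?thesis unfolding recognizes_def
  proof (intro exI[of _ \<tau>] conjI allI impI)
    show "typing q N (neg_algebra q N A) \<tau>"
      using \<tau> by (simp add: typing_def neg_algebra_def)
  qed (simp add: neg_algebra_def L linked_less[OF \<tau>])
qed

lemma linked_image: "linked \<tau> x p s e \<Longrightarrow> linked (\<lambda>u. f (\<tau> u)) x p (f s) (f e)"
  by (simp add: linked_def)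

text \<open>Direct product with pairs coded as numbers. Numbers below the size that code no pair of
  elements are harmless, since \<open>typing\<close> constrains only the types of words.\<close>

definition conj_algebra :: "nat \<Rightarrow> nat \<Rightarrow> nat \<Rightarrow> nat \<Rightarrow> nat" where
  "conj_algebra q N A B = algebra q N (prod_encode (alg_size A, alg_size B))
     (\<lambda>a b. prod_encode (alg_mult A (left a) (left b), alg_mult B (right a) (right b)))
     (\<lambda>l. prod_encode (alg_letter A l, alg_letter B l))
     (\<lambda>s e. alg_accept A (left s) (left e) \<and> alg_accept B (right s) (right e))"

lemma recognizes_conj:
  assumes "recognizes q N A L" "recognizes q N B M"
  shows "recognizes q N (conj_algebra q N A B) (\<lambda>x. L x \<and> M x)"
proof -
  from assms(1) obtain \<tau> where \<tau>: "typing q N A \<tau>" and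
    L: "\<And>x p s e. range x \<subseteq> letters q N \<Longrightarrow> linked \<tau> x p s e \<Longrightarrow> alg_accept A s e \<longleftrightarrow> L x"
    unfolding recognizes_def by blast
  from assms(2) obtain \<sigma> where \<sigma>: "typing q N B \<sigma>" and
    M: "\<And>x p s e. range x \<subseteq> letters q N \<Longrightarrow> linked \<sigma> x p s e \<Longrightarrow> alg_accept B s e \<longleftrightarrow> M x"
    unfolding recognizes_def by blast
  let ?\<rho> = "\<lambda>u. prod_encode (\<tau> u, \<sigma> u)"
  have less: "?\<rho> u < prod_encode (alg_size A, alg_size B)"
    if "u \<noteq> []" "set u \<subseteq> letters q N" for u
    using typing_less[OF \<tau> that] typing_less[OF \<sigma> that] by (intro prod_encode_mono) auto
  have ty: "typing q N (conj_algebra q N A B) ?\<rho>"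
    unfolding typing_def
  proof (intro conjI allI impI ballI)
    show "?\<rho> u < alg_size (conj_algebra q N A B)" if "u \<noteq> []" "set u \<subseteq> letters q N" for u
      using less[OF that] by (simp add: conj_algebra_def)
  qed (simp_all add: conj_algebra_def less typing_letter[OF \<tau>] typing_letter[OF \<sigma>]
      typing_append[OF \<tau>] typing_append[OF \<sigma>])
  show ?thesis unfolding recognizes_def
  proof (intro exI[of _ ?\<rho>] conjI allI impI ty)
    fix x p s e
    assume x: "range x \<subseteq> letters q N" and lk: "linked ?\<rho> x p s e"
    have "linked \<tau> x p (left s) (left e)" "linked \<sigma> x p (right s) (right e)"
      using linked_image[OF lk, of left] linked_image[OF lk, of right] by simp_all
    then show "alg_accept (conj_algebra q N A B) s e \<longleftrightarrow> L x \<and> M x"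
      using linked_less[OF ty x lk] L[OF x] M[OF x] by (simp add: conj_algebra_def)
  qed
qed

text \<open>
  The value of a first-order variable will be the first position of its track; then all atomic
  formulas say that the first position with a certain event is a good one.
\<close>

definition lang_first :: "('a \<Rightarrow> bool) \<Rightarrow> ('a \<Rightarrow> bool) \<Rightarrow> (nat \<Rightarrow> 'a) \<Rightarrow> bool" where
  "lang_first ev good x \<longleftrightarrow> (\<exists>i. ev (x i) \<and> good (x i) \<and> (\<forall>j<i. \<not> ev (x j)))"

text \<open>0, 1 and 2 stand for no event, a good first event and a bad first event; the product
  keeps the first nonzero factor. Acceptance can look at \<open>s\<close> alone because all prefixes
  up to cut points have type \<open>s\<close> and some of them reach the first event, if there is
  one.\<close>

definition first_algebra :: "nat \<Rightarrow> nat \<Rightarrow> (nat \<Rightarrow> bool) \<Rightarrow> (nat \<Rightarrow> bool) \<Rightarrow> nat" where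
  "first_algebra q N ev good = algebra q N 3 (\<lambda>a b. if a = 0 then b else a)
     (\<lambda>l. if ev l then if good l then 1 else 2 else 0) (\<lambda>s e. s = 1)"

primrec first_type :: "('a \<Rightarrow> bool) \<Rightarrow> ('a \<Rightarrow> bool) \<Rightarrow> 'a list \<Rightarrow> nat" where
  "first_type ev good [] = 0"
| "first_type ev good (a # u) =
     (if ev a then if good a then 1 else 2 else first_type ev good u)"

lemma first_type_less: "first_type ev good u < 3"
  by (induction u) auto

lemma first_type_append:
  "first_type ev good (u @ v) =
     (if first_type ev good u = 0 then first_type ev good v else first_type ev good u)"
  by (induction u) auto

lemma first_type_eq_0: "first_type ev good u = 0 \<longleftrightarrow> (\<forall>a\<in>set u. \<not> ev a)"
  by (induction u) auto

lemma first_type_eq_1I: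
  assumes "i < n" "ev (x i)" "good (x i)" "\<forall>j<i. \<not> ev (x j)"
  shows "first_type ev good (map x [0..<n]) = 1"
proof -
  have "map x [0..<n] = map x [0..<i] @ map x [i..<n]"
    using assms(1) by (simp add: map_upt_append)
  also have "first_type ev good \<dots> = first_type ev good (map x [i..<n])"
    using assms(4) by (simp add: first_type_append first_type_eq_0)
  also have "\<dots> = 1"
    using assms(1-3) by (simp add: upt_conv_Cons)
  finally show ?thesis .
qed

lemma first_type_eq_1D:
  assumes "first_type ev good (map x [0..<n]) = 1"
  shows "lang_first ev good x"
  using assms
proof (induction n)
  case (Suc n)
  show ?case
  proof (cases "first_type ev good (map x [0..<n]) = 0")
    case True
    then have "\<forall>j<n. \<not> ev (x j)" by (simp add: first_type_eq_0)
    moreover have "ev (x n)" "good (x n)"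
      using Suc.prems True by (simp_all add: first_type_append split: if_splits)
    ultimately show ?thesis unfolding lang_first_def by blast
  next
    case False
    then show ?thesis using Suc by (simp add: first_type_append)
  qed
qed simp

lemma recognizes_first:
  assumes "\<And>a. a \<in> letters q N \<Longrightarrow> ev (code_letter a) \<longleftrightarrow> ev' a"
    and "\<And>a. a \<in> letters q N \<Longrightarrow> good (code_letter a) \<longleftrightarrow> good' a"
  shows "recognizes q N (first_algebra q N ev good) (lang_first ev' good')"
proof -
  have ty: "typing q N (first_algebra q N ev good) (first_type ev' good')"
    unfolding typing_def
    by (auto simp: assms first_algebra_def first_type_append first_type_less)
  show ?thesis unfolding recognizes_def
  proof (intro exI conjI allI impI, rule ty)
    fix x p s e
    assume x: "range x \<subseteq> letters q N" and lk: "linked (first_type ev' good') x p s e"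
    have s: "first_type ev' good' (map x [0..<p j]) = s" for j
      using lk by (simp add: linked_def)
    have "alg_accept (first_algebra q N ev good) s e \<longleftrightarrow> s = 1"
      using linked_less[OF ty x lk] by (simp add: first_algebra_def)
    also have "\<dots> \<longleftrightarrow> lang_first ev' good' x"
    proof
      assume "s = 1"
      then show "lang_first ev' good' x"
        using s[of 0] by (simp add: first_type_eq_1D)
    next
      assume "lang_first ev' good' x"
      then obtain i where i: "ev' (x i)" "good' (x i)" "\<forall>j<i. \<not> ev' (x j)"
        unfolding lang_first_def by blast
      \<comment> \<open>Any cut point beyond the event will do; strict monotonicity supplies one
        explicitly.\<close>
      have "i < p (Suc i)"
        using strict_mono_imp_increasing[of p "Suc i"] lk by (simp add: linked_def)
      then have "first_type ev' good' (map x [0..<p (Suc i)]) = 1"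
        using i by (rule first_type_eq_1I)
      then show "s = 1" using s by simp
    qed
    finally show "alg_accept (first_algebra q N ev good) s e \<longleftrightarrow> lang_first ev' good' x" .
  qed
qed

section \<open>Existential quantification as projection of a track\<close>

definition variant :: "nat \<Rightarrow> letter \<Rightarrow> letter \<Rightarrow> bool" where
  "variant v a b \<longleftrightarrow> fst a = fst b \<and> snd a - {v} = snd b - {v}"

text \<open>Track \<open>v\<close> of \<open>x\<close> is ignored rather than assumed empty, so a
  quantifier may rebind a variable whose track already carries marks.\<close>

definition lang_ex :: "nat \<Rightarrow> ((nat \<Rightarrow> letter) \<Rightarrow> bool) \<Rightarrow> (nat \<Rightarrow> letter) \<Rightarrow> bool" where
  "lang_ex v L x \<longleftrightarrow> (\<exists>y. (\<forall>i. variant v (y i) (x i)) \<and> L y)"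

text \<open>An element codes a set of elements of \<open>A\<close>: the types of all relabellings of
  track \<open>v\<close>. The equations on \<open>i\<close> and \<open>j\<close> are those of a
  linked pair; they are what allows a word with this pair to be assembled from relabelled
  blocks.\<close>

definition ex_algebra :: "nat \<Rightarrow> nat \<Rightarrow> nat \<Rightarrow> nat \<Rightarrow> nat" where
  "ex_algebra q N v A = algebra q N (2 ^ alg_size A)
     (\<lambda>a b. set_encode {k. k < alg_size A \<and> (\<exists>i<alg_size A. \<exists>j<alg_size A.
        i \<in> set_decode a \<and> j \<in> set_decode b \<and> k = alg_mult A i j)})
     (\<lambda>l. set_encode {k. k < alg_size A \<and>
        (k = alg_letter A (prod_encode (left l,
           set_encode {i. i < N \<and> (i = v \<or> i \<in> set_decode (right l))})) \<or>
         k = alg_letter A (prod_encode (left l,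
           set_encode {i. i < N \<and> (i \<noteq> v \<and> i \<in> set_decode (right l))})))})
     (\<lambda>s e. \<exists>i<alg_size A. \<exists>j<alg_size A. i \<in> set_decode s \<and> j \<in> set_decode e \<and>
        alg_mult A j j = j \<and> alg_mult A i j = i \<and> alg_accept A i j)"

lemma variant_in_letters:
  "v < N \<Longrightarrow> variant v a b \<Longrightarrow> b \<in> letters q N \<Longrightarrow> a \<in> letters q N"
proof -
  assume v: "v < N" and ab: "variant v a b" and b: "b \<in> letters q N"
  from ab have "snd a \<subseteq> insert v (snd b)" unfolding variant_def by blast
  with v ab b show ?thesis by (auto simp: variant_def mem_letters_iff)
qed

lemma variant_iff: "variant v a b \<longleftrightarrow> a = (fst b, insert v (snd b)) \<or> a = (fst b, snd b - {v})"
proof -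
  have "A - {v} = B - {v} \<longleftrightarrow> A = insert v B \<or> A = B - {v}" for A B by blast
  then show ?thesis by (simp add: variant_def prod_eq_iff) blast
qed

lemma list_all2_variant_letters:
  assumes "v < N" "list_all2 (variant v) u' u" "set u \<subseteq> letters q N"
  shows "set u' \<subseteq> letters q N"
  using assms(2,3) by induction (auto dest: variant_in_letters[OF assms(1)])

lemma exists_block:
  fixes p :: "nat \<Rightarrow> nat"
  assumes "strict_mono p" "p 0 = 0"
  shows "\<exists>i. p i \<le> k \<and> k < p (Suc i)"
proof -
  have ex: "\<exists>i. k < p (Suc i)"
    using strict_mono_imp_increasing[OF assms(1), of "Suc k"] by (intro exI[of _ k]) simp
  define i where "i = (LEAST i. k < p (Suc i))"
  have "k < p (Suc i)" unfolding i_def using ex by (rule LeastI_ex)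
  moreover have "p i \<le> k"
  proof (cases i)
    case (Suc j)
    then have "\<not> k < p (Suc j)" unfolding i_def by (metis lessI not_less_Least)
    then show ?thesis using Suc by simp
  qed (simp add: assms(2))
  ultimately show ?thesis by blast
qed

text \<open>Converse of cutting at \<open>p\<close>: position \<open>k\<close> reads from the only
  block that contains it. This turns separate choices for all blocks into one infinite word.\<close>

lemma glue_blocks:
  fixes p :: "nat \<Rightarrow> nat"
  assumes "strict_mono p" "p 0 = 0" "\<And>i. length (u i) = p (Suc i) - p i"
  obtains x where "\<And>i. map x [p i..<p (Suc i)] = u i"
proof -
  have unique: "i = j" if "p i \<le> k" "k < p (Suc i)" "p j \<le> k" "k < p (Suc j)" for i j k
  proof -
    have "i < Suc j" "j < Suc i"
      using that strict_mono_less[OF assms(1)] by (meson le_less_trans)+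
    then show ?thesis by simp
  qed
  define b where "b k = (SOME i. p i \<le> k \<and> k < p (Suc i))" for k
  have b: "b k = i" if "p i \<le> k" "k < p (Suc i)" for i k
  proof -
    have "p (b k) \<le> k \<and> k < p (Suc (b k))" unfolding b_def by (rule someI) (use that in auto)
    then show ?thesis using unique that by blast
  qed
  show thesis
  proof (rule that[of "\<lambda>k. u (b k) ! (k - p (b k))"])
    show "map (\<lambda>k. u (b k) ! (k - p (b k))) [p i..<p (Suc i)] = u i" for i
    proof (rule nth_equalityI)
      show "map (\<lambda>k. u (b k) ! (k - p (b k))) [p i..<p (Suc i)] ! j = u i ! j"
        if "j < length (map (\<lambda>k. u (b k) ! (k - p (b k))) [p i..<p (Suc i)])" for j
        using that b[of i "p i + j"] by simp
    qed (simp add: assms(3))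
  qed
qed

definition ex_values :: "(letter list \<Rightarrow> nat) \<Rightarrow> nat \<Rightarrow> letter list \<Rightarrow> nat set" where
  "ex_values \<tau> v u = \<tau> ` {u'. list_all2 (variant v) u' u}"

lemma ex_values_subset:
  assumes "typing q N A \<tau>" "v < N" "u \<noteq> []" "set u \<subseteq> letters q N"
  shows "ex_values \<tau> v u \<subseteq> {..<alg_size A}"
proof
  fix k assume "k \<in> ex_values \<tau> v u"
  then obtain u' where u': "list_all2 (variant v) u' u" "k = \<tau> u'"
    by (auto simp: ex_values_def)
  then have "u' \<noteq> []" using assms(3) by auto
  then show "k \<in> {..<alg_size A}"
    using typing_less[OF assms(1) _ list_all2_variant_letters[OF assms(2) u'(1) assms(4)]] u'(2)
    by simp
qed

text \<open>Relabelling acts letter by letter, so a relabelling of a concatenation is a pair of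
  independent relabellings.\<close>

lemma ex_values_append:
  assumes "typing q N A \<tau>" "v < N" "u \<noteq> []" "w \<noteq> []"
    "set u \<subseteq> letters q N" "set w \<subseteq> letters q N"
  shows "k \<in> ex_values \<tau> v (u @ w) \<longleftrightarrow>
    (\<exists>i\<in>ex_values \<tau> v u. \<exists>j\<in>ex_values \<tau> v w. k = alg_mult A i j)"
proof -
  have app: "\<tau> (u' @ w') = alg_mult A (\<tau> u') (\<tau> w')"
    if "list_all2 (variant v) u' u" "list_all2 (variant v) w' w" for u' w'
  proof (rule typing_append[OF assms(1)])
    show "u' \<noteq> []" "w' \<noteq> []" using that assms(3,4) by auto
  qed (use list_all2_variant_letters[OF assms(2)] that assms(5,6) in blast)+
  show ?thesis
  proof
    assume "k \<in> ex_values \<tau> v (u @ w)"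
    then obtain u' w' where u': "list_all2 (variant v) u' u" "list_all2 (variant v) w' w"
      "k = \<tau> (u' @ w')"
      by (auto simp: ex_values_def list_all2_append2)
    then show "\<exists>i\<in>ex_values \<tau> v u. \<exists>j\<in>ex_values \<tau> v w. k = alg_mult A i j"
      unfolding ex_values_def using app[OF u'(1,2)] by blast
  next
    assume "\<exists>i\<in>ex_values \<tau> v u. \<exists>j\<in>ex_values \<tau> v w. k = alg_mult A i j"
    then obtain u' w' where u': "list_all2 (variant v) u' u" "list_all2 (variant v) w' w"
      "k = alg_mult A (\<tau> u') (\<tau> w')"
      by (auto simp: ex_values_def)
    then have "k = \<tau> (u' @ w')" using app by simp
    then show "k \<in> ex_values \<tau> v (u @ w)"
      unfolding ex_values_def using list_all2_appendI[OF u'(1,2)] by blast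
  qed
qed

lemma typing_ex:
  assumes \<tau>: "typing q N A \<tau>" and v: "v < N"
  shows "typing q N (ex_algebra q N v A) (\<lambda>u. set_encode (ex_values \<tau> v u))"
  unfolding typing_def
proof (intro conjI allI impI ballI)
  fix u assume "u \<noteq> []" "set u \<subseteq> letters q N"
  then show "set_encode (ex_values \<tau> v u) < alg_size (ex_algebra q N v A)"
    by (simp add: ex_algebra_def set_encode_less ex_values_subset[OF \<tau> v])
next
  fix a assume a: "a \<in> letters q N"
  have dec_a: "set_decode (right (code_letter a)) = snd a" using a by simp
  have "{i. i < N \<and> (i = v \<or> i \<in> snd a)} = insert v (snd a)"
    "{i. i < N \<and> (i \<noteq> v \<and> i \<in> snd a)} = snd a - {v}"
    using a v by (auto simp: mem_letters_iff)
  then have l: "prod_encode (left (code_letter a),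
      set_encode {i. i < N \<and> (i = v \<or> i \<in> set_decode (right (code_letter a)))})
       = code_letter (fst a, insert v (snd a))"
    "prod_encode (left (code_letter a),
      set_encode {i. i < N \<and> (i \<noteq> v \<and> i \<in> set_decode (right (code_letter a)))})
       = code_letter (fst a, snd a - {v})"
    unfolding dec_a by (simp_all add: code_letter_def)
  have in_letters: "(fst a, insert v (snd a)) \<in> letters q N" "(fst a, snd a - {v}) \<in> letters q N"
    using a v by (auto simp: mem_letters_iff)
  have "{u'. list_all2 (variant v) u' [a]} = {[(fst a, insert v (snd a))], [(fst a, snd a - {v})]}"
    by (auto simp: list_all2_Cons2 variant_iff)
  then have "ex_values \<tau> v [a] = {alg_letter A (code_letter (fst a, insert v (snd a))),
      alg_letter A (code_letter (fst a, snd a - {v}))}"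
    by (simp add: ex_values_def typing_letter[OF \<tau>] in_letters)
  moreover have "ex_values \<tau> v [a] \<subseteq> {..<alg_size A}"
    using a by (intro ex_values_subset[OF \<tau> v]) auto
  ultimately have "ex_values \<tau> v [a] = {k. k < alg_size A \<and>
      (k = alg_letter A (code_letter (fst a, insert v (snd a)))
      \<or> k = alg_letter A (code_letter (fst a, snd a - {v})))}"
    by blast
  then show "set_encode (ex_values \<tau> v [a]) = alg_letter (ex_algebra q N v A) (code_letter a)"
    unfolding ex_algebra_def by (simp only: alg_letter_algebra[OF a] l)
next
  fix u w :: "letter list"
  assume uw: "u \<noteq> []" "w \<noteq> []" "set u \<subseteq> letters q N" "set w \<subseteq> letters q N"
  have sub: "ex_values \<tau> v u \<subseteq> {..<alg_size A}" "ex_values \<tau> v w \<subseteq> {..<alg_size A}"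
    "ex_values \<tau> v (u @ w) \<subseteq> {..<alg_size A}"
    by (rule ex_values_subset[OF \<tau> v]; use uw in simp)+
  have "ex_values \<tau> v (u @ w) = {k. k < alg_size A \<and> (\<exists>i<alg_size A. \<exists>j<alg_size A.
      i \<in> ex_values \<tau> v u \<and> j \<in> ex_values \<tau> v w \<and> k = alg_mult A i j)}"
    using ex_values_append[OF \<tau> v uw] sub by blast
  moreover have "set_encode (ex_values \<tau> v u) < 2 ^ alg_size A"
    "set_encode (ex_values \<tau> v w) < 2 ^ alg_size A"
    using sub by (auto intro!: set_encode_less)
  moreover have "finite (ex_values \<tau> v u)" "finite (ex_values \<tau> v w)"
    using sub by (auto intro: finite_subset)
  ultimately show "set_encode (ex_values \<tau> v (u @ w)) = alg_mult (ex_algebra q N v A)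
      (set_encode (ex_values \<tau> v u)) (set_encode (ex_values \<tau> v w))"
    by (simp add: ex_algebra_def)
qed

text \<open>An accepting pair \<open>(a, b)\<close> from the two sets lets every block be relabelled
  to type \<open>a\<close> or \<open>b\<close>, and the blocks are glued. Conversely, a relabelled
  word \<open>y\<close> need not be linked at the given cut points, but by Ramsey it is linked at a
  subsequence of them.\<close>

lemma recognizes_ex:
  assumes "recognizes q N A L" and v: "v < N"
  shows "recognizes q N (ex_algebra q N v A) (lang_ex v L)"
proof -
  from assms(1) obtain \<tau> where \<tau>: "typing q N A \<tau>" and
    L: "\<And>x p s e. range x \<subseteq> letters q N \<Longrightarrow> linked \<tau> x p s e \<Longrightarrow> alg_accept A s e \<longleftrightarrow> L x"
    unfolding recognizes_def by blast
  note ty = typing_ex[OF \<tau> v]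
  show ?thesis unfolding recognizes_def
  proof (intro exI conjI allI impI, rule ty)
    fix x p s e
    assume x: "range x \<subseteq> letters q N"
      and lk: "linked (\<lambda>u. set_encode (ex_values \<tau> v u)) x p s e"
    have p: "strict_mono p" "0 < p 0" using lk by (auto simp: linked_def)
    have dec: "set_decode (set_encode (ex_values \<tau> v (map x [i..<j]))) = ex_values \<tau> v (map x [i..<j])"
      if "i < j" for i j
      using that ex_values_subset[OF \<tau> v _ set_segment_subset[OF x, of i j]]
      by (simp add: finite_subset)
    have s: "set_decode s = ex_values \<tau> v (map x [0..<p j])" for j
    proof -
      have "0 < p j" using p strict_mono_less_eq[OF p(1), of 0 j] by simp
      from dec[OF this] lk show ?thesis by (simp add: linked_def)
    qed
    \<comment> \<open>Arbitrary \<open>i < j\<close> are needed, since thinning the cut points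
      merges neighbouring segments.\<close>
    have e: "set_decode e = ex_values \<tau> v (map x [p i..<p j])" if "i < j" for i j
    proof -
      have "p i < p j" using that p(1) by (simp add: strict_mono_less)
      from dec[OF this] lk that show ?thesis by (simp add: linked_def)
    qed
    have "alg_accept (ex_algebra q N v A) s e \<longleftrightarrow> (\<exists>i<alg_size A. \<exists>j<alg_size A.
        i \<in> set_decode s \<and> j \<in> set_decode e \<and>
        alg_mult A j j = j \<and> alg_mult A i j = i \<and> alg_accept A i j)"
      using linked_less[OF ty x lk] by (simp add: ex_algebra_def)
    also have "\<dots> \<longleftrightarrow> lang_ex v L x"
    proof
      assume "\<exists>i<alg_size A. \<exists>j<alg_size A. i \<in> set_decode s \<and> j \<in> set_decode e \<and>
        alg_mult A j j = j \<and> alg_mult A i j = i \<and> alg_accept A i j"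
      then obtain a b where ab: "a \<in> set_decode s" "b \<in> set_decode e"
        "alg_mult A b b = b" "alg_mult A a b = a" "alg_accept A a b"
        by blast
      obtain u0 where u0: "list_all2 (variant v) u0 (map x [0..<p 0])" "\<tau> u0 = a"
        using ab(1) unfolding s[of 0] ex_values_def by blast
      have "\<exists>u. list_all2 (variant v) u (map x [p i..<p (Suc i)]) \<and> \<tau> u = b" for i
        using ab(2) unfolding e[OF lessI[of i]] ex_values_def by blast
      then obtain u where u: "\<And>i. list_all2 (variant v) (u i) (map x [p i..<p (Suc i)])"
        "\<And>i. \<tau> (u i) = b"
        by metis
      \<comment> \<open>With 0 as an additional cut point the prefix becomes block 0, and all
        indices shift by one.\<close>
      let ?p = "case_nat 0 p" and ?u = "case_nat u0 u"
      have p': "strict_mono ?p"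
        unfolding strict_mono_Suc_iff using p by (auto split: nat.split simp: strict_mono_Suc_iff)
      have var: "list_all2 (variant v) (?u i) (map x [?p i..<?p (Suc i)])" for i
        using u0(1) u(1) by (cases i) simp_all
      have len: "length (?u i) = ?p (Suc i) - ?p i" for i
        using list_all2_lengthD[OF var[of i]] by simp
      obtain y where y: "\<And>i. map y [?p i..<?p (Suc i)] = ?u i"
        using glue_blocks[of ?p ?u, OF p' _ len] by auto
      have yx: "variant v (y k) (x k)" for k
      proof -
        obtain i where i: "?p i \<le> k" "k < ?p (Suc i)"
          using exists_block[OF p', of k] by auto
        have "list_all2 (variant v) (map y [?p i..<?p (Suc i)]) (map x [?p i..<?p (Suc i)])"
          using var[of i] unfolding y .
        from list_all2_nthD2[OF this, of "k - ?p i"] i show ?thesis by simp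
      qed
      have y_letters: "range y \<subseteq> letters q N"
        using x variant_in_letters[OF v yx] by blast
      have "linked \<tau> y p a b"
      proof (rule linkedI[OF \<tau> y_letters p])
        show "\<tau> (map y [0..<p 0]) = a" using y[of 0] u0(2) by simp
        show "\<tau> (map y [p i..<p (Suc i)]) = b" for i using y[of "Suc i"] u(2) by simp
      qed (use ab in auto)
      with L[OF y_letters] ab(5) yx show "lang_ex v L x" unfolding lang_ex_def by blast
    next
      assume "lang_ex v L x"
      then obtain y where yx: "\<And>k. variant v (y k) (x k)" and y: "L y"
        unfolding lang_ex_def by blast
      have y_letters: "range y \<subseteq> letters q N"
        using x variant_in_letters[OF v yx] by blast
      \<comment> \<open>The thinned segments still have their types in the sets coded by
        \<open>s\<close> and \<open>e\<close>, as these describe every segment between cut points of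
        \<open>p\<close>.\<close>
      obtain r a b where r: "strict_mono r" and lk': "linked \<tau> y (p \<circ> r) a b"
        by (rule linked_subsequence_exists[OF \<tau> y_letters p(1)])
      have "list_all2 (variant v) (map y [i..<j]) (map x [i..<j])" for i j
        using yx by (simp add: list_all2_conv_all_nth)
      then have y_values: "\<tau> (map y [i..<j]) \<in> ex_values \<tau> v (map x [i..<j])" for i j
        unfolding ex_values_def by blast
      have "a = \<tau> (map y [0..<p (r 0)])" "b = \<tau> (map y [p (r 0)..<p (r 1)])"
        using lk' by (simp_all add: linked_def)
      moreover have "r 0 < r 1" using r by (simp add: strict_mono_less)
      ultimately have "a \<in> set_decode s" "b \<in> set_decode e"
        using s[of "r 0"] e[of "r 0" "r 1"] y_values by simp_all
      then show "\<exists>i<alg_size A. \<exists>j<alg_size A. i \<in> set_decode s \<and> j \<in> set_decode e \<and>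
        alg_mult A j j = j \<and> alg_mult A i j = i \<and> alg_accept A i j"
        using linked_less[OF \<tau> y_letters lk'] linked_idempotent[OF \<tau> y_letters lk']
          L[OF y_letters lk'] y by blast
    qed
    finally show "alg_accept (ex_algebra q N v A) s e \<longleftrightarrow> lang_ex v L x" .
  qed
qed

section \<open>From formulas to algebras\<close>

text \<open>\<open>Less x y\<close> asks that \<open>y\<close> be unmarked where the first mark of
  either variable occurs. In \<open>Ex1\<close> the additional conjunct makes the new track
  nonempty; several marks do no harm because only the first counts.\<close>

primrec lang :: "('a \<Rightarrow> nat) \<Rightarrow> 'a mso \<Rightarrow> (nat \<Rightarrow> letter) \<Rightarrow> bool" where
  "lang c (Less x y) = lang_first (\<lambda>a. 2 * x \<in> snd a \<or> 2 * y \<in> snd a) (\<lambda>a. 2 * y \<notin> snd a)"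
| "lang c (Equal x y) = lang_first (\<lambda>a. 2 * x \<in> snd a \<or> 2 * y \<in> snd a)
     (\<lambda>a. 2 * x \<in> snd a \<and> 2 * y \<in> snd a)"
| "lang c (Symbol s x) = lang_first (\<lambda>a. 2 * x \<in> snd a) (\<lambda>a. fst a = c s)"
| "lang c (Member x X) = lang_first (\<lambda>a. 2 * x \<in> snd a) (\<lambda>a. Suc (2 * X) \<in> snd a)"
| "lang c (Neg \<phi>) = (\<lambda>w. \<not> lang c \<phi> w)"
| "lang c (Conj \<phi> \<psi>) = (\<lambda>w. lang c \<phi> w \<and> lang c \<psi> w)"
| "lang c (Ex1 x \<phi>) =
     lang_ex (2 * x) (\<lambda>w. lang_first (\<lambda>a. 2 * x \<in> snd a) (\<lambda>a. True) w \<and> lang c \<phi> w)"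
| "lang c (Ex2 X \<phi>) = lang_ex (Suc (2 * X)) (lang c \<phi>)"

lemma lang_first_iff:
  assumes "ev (w k)" "\<And>j. j < k \<Longrightarrow> \<not> ev (w j)"
  shows "lang_first ev good w \<longleftrightarrow> good (w k)"
  unfolding lang_first_def using assms by (metis nat_neq_iff)

lemma variant_mem_iff: "variant v a b \<Longrightarrow> u \<noteq> v \<Longrightarrow> u \<in> snd a \<longleftrightarrow> u \<in> snd b"
  unfolding variant_def by blast

text \<open>The conditions on tracks concern free variables only. Thus a bound variable may share
  its track with an outer one, and for a sentence the unmarked word qualifies.\<close>

lemma lang_iff_sat:
  assumes "inj c" "\<And>i. fst (w i) = c (W i)"
    and "\<And>x. x \<in> free1 \<phi> \<Longrightarrow> 2 * x \<in> snd (w (e x)) \<and> (\<forall>j<e x. 2 * x \<notin> snd (w j))"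
    and "\<And>X i. X \<in> free2 \<phi> \<Longrightarrow> i \<in> E X \<longleftrightarrow> Suc (2 * X) \<in> snd (w i)"
  shows "lang c \<phi> w \<longleftrightarrow> sat W e E \<phi>"
  using assms(2-)
proof (induction \<phi> arbitrary: w e E)
  case (Less x y)
  then have x: "2 * x \<in> snd (w (e x))" "\<And>j. j < e x \<Longrightarrow> 2 * x \<notin> snd (w j)"
    and y: "2 * y \<in> snd (w (e y))" "\<And>j. j < e y \<Longrightarrow> 2 * y \<notin> snd (w j)"
    by simp_all
  have "lang c (Less x y) w \<longleftrightarrow> 2 * y \<notin> snd (w (min (e x) (e y)))"
    unfolding lang.simps by (rule lang_first_iff) (use x y in \<open>auto simp: min_def split: if_splits\<close>)
  also have "\<dots> \<longleftrightarrow> e x < e y"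
    using y by (auto simp: min_def le_less)
  finally show ?case by simp
next
  case (Equal x y)
  then have x: "2 * x \<in> snd (w (e x))" "\<And>j. j < e x \<Longrightarrow> 2 * x \<notin> snd (w j)"
    and y: "2 * y \<in> snd (w (e y))" "\<And>j. j < e y \<Longrightarrow> 2 * y \<notin> snd (w j)"
    by simp_all
  have "lang c (Equal x y) w \<longleftrightarrow> 2 * x \<in> snd (w (min (e x) (e y))) \<and>
      2 * y \<in> snd (w (min (e x) (e y)))"
    unfolding lang.simps by (rule lang_first_iff) (use x y in \<open>auto simp: min_def split: if_splits\<close>)
  also have "\<dots> \<longleftrightarrow> e x = e y"
    using x y by (cases "e x" "e y" rule: linorder_cases) auto
  finally show ?case by simp
next
  case (Symbol s x)
  have "lang c (Symbol s x) w \<longleftrightarrow> fst (w (e x)) = c s"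
    unfolding lang.simps by (rule lang_first_iff) (use Symbol in auto)
  then show ?case using Symbol.prems(1) inj_eq[OF assms(1)] by auto
next
  case (Member x X)
  have "lang c (Member x X) w \<longleftrightarrow> Suc (2 * X) \<in> snd (w (e x))"
    unfolding lang.simps by (rule lang_first_iff) (use Member in auto)
  then show ?case using Member.prems(3) by simp
next
  case (Neg \<phi>)
  from Neg.IH[of w e E] Neg.prems show ?case by simp
next
  case (Conj \<phi> \<psi>)
  from Conj.IH(1)[of w e E] Conj.IH(2)[of w e E] Conj.prems show ?case by simp
next
  case (Ex1 x \<phi>)
  have var: "lang c \<phi> w' \<longleftrightarrow> sat W (e(x := n)) E \<phi>"
    if w': "\<And>i. variant (2 * x) (w' i) (w i)" and n: "2 * x \<in> snd (w' n)" "\<forall>j<n. 2 * x \<notin> snd (w' j)"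
    for w' n
  proof (rule Ex1.IH)
    show "fst (w' i) = c (W i)" for i
      using w'[of i] Ex1.prems(1) by (simp add: variant_def)
    show "2 * y \<in> snd (w' ((e(x := n)) y)) \<and> (\<forall>j<(e(x := n)) y. 2 * y \<notin> snd (w' j))"
      if "y \<in> free1 \<phi>" for y
      using n that Ex1.prems(2)[of y] variant_mem_iff[OF w', of "2 * y"] by (cases "y = x") auto
    show "i \<in> E X \<longleftrightarrow> Suc (2 * X) \<in> snd (w' i)" if "X \<in> free2 \<phi>" for X i
    proof -
      have "Suc (2 * X) \<noteq> 2 * x" by presburger
      then show ?thesis
        using that Ex1.prems(3)[of X i] variant_mem_iff[OF w', of "Suc (2 * X)" i] by simp
    qed
  qed
  show ?case
  proof
    assume "lang c (Ex1 x \<phi>) w"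
    then obtain w' n where "\<And>i. variant (2 * x) (w' i) (w i)" "2 * x \<in> snd (w' n)"
      "\<forall>j<n. 2 * x \<notin> snd (w' j)" "lang c \<phi> w'"
      by (auto simp: lang_ex_def lang_first_def)
    with var[of w' n] show "sat W e E (Ex1 x \<phi>)" by auto
  next
    assume "sat W e E (Ex1 x \<phi>)"
    then obtain n where n: "sat W (e(x := n)) E \<phi>" by auto
    \<comment> \<open>Track \<open>2 * x\<close> is cleared except at \<open>n\<close>, so that
      earlier marks cannot precede the intended value.\<close>
    define w' where "w' i = (fst (w i), if i = n then insert (2 * x) (snd (w i)) else snd (w i) - {2 * x})" for i
    have w': "variant (2 * x) (w' i) (w i)" for i
      by (simp add: w'_def variant_iff)
    have wn: "2 * x \<in> snd (w' n)" "\<forall>j<n. 2 * x \<notin> snd (w' j)"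
      by (auto simp: w'_def)
    have "lang_first (\<lambda>a. 2 * x \<in> snd a) (\<lambda>a. True) w'"
      unfolding lang_first_def using wn by blast
    with var[OF w' wn] n w' show "lang c (Ex1 x \<phi>) w" by (auto simp: lang_ex_def)
  qed
next
  case (Ex2 X \<phi>)
  have var: "lang c \<phi> w' \<longleftrightarrow> sat W e (E(X := A)) \<phi>"
    if w': "\<And>i. variant (Suc (2 * X)) (w' i) (w i)" and A: "\<And>i. i \<in> A \<longleftrightarrow> Suc (2 * X) \<in> snd (w' i)"
    for w' A
  proof (rule Ex2.IH)
    show "fst (w' i) = c (W i)" for i
      using w'[of i] Ex2.prems(1) by (simp add: variant_def)
    show "2 * y \<in> snd (w' (e y)) \<and> (\<forall>j<e y. 2 * y \<notin> snd (w' j))"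
      if "y \<in> free1 \<phi>" for y
    proof -
      have "2 * y \<noteq> Suc (2 * X)" by presburger
      then show ?thesis
        using that Ex2.prems(2)[of y] variant_mem_iff[OF w', of "2 * y"] by simp
    qed
    show "i \<in> (E(X := A)) Y \<longleftrightarrow> Suc (2 * Y) \<in> snd (w' i)" if "Y \<in> free2 \<phi>" for Y i
      using A that Ex2.prems(3)[of Y i] variant_mem_iff[OF w', of "Suc (2 * Y)" i]
      by (cases "Y = X") simp_all
  qed
  show ?case
  proof
    assume "lang c (Ex2 X \<phi>) w"
    then obtain w' where "\<And>i. variant (Suc (2 * X)) (w' i) (w i)" "lang c \<phi> w'"
      by (auto simp: lang_ex_def)
    with var[of w' "{i. Suc (2 * X) \<in> snd (w' i)}"] show "sat W e E (Ex2 X \<phi>)" by auto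
  next
    assume "sat W e E (Ex2 X \<phi>)"
    then obtain A where A: "sat W e (E(X := A)) \<phi>" by auto
    define w' where "w' i = (fst (w i), if i \<in> A then insert (Suc (2 * X)) (snd (w i))
      else snd (w i) - {Suc (2 * X)})" for i
    have w': "variant (Suc (2 * X)) (w' i) (w i)" for i
      by (simp add: w'_def variant_iff)
    have "i \<in> A \<longleftrightarrow> Suc (2 * X) \<in> snd (w' i)" for i
      by (simp add: w'_def)
    with var[OF w', of A] A w' show "lang c (Ex2 X \<phi>) w" by (auto simp: lang_ex_def)
  qed
qed

text \<open>The cases follow the tags of \<open>code\<close>, and the last one also takes all larger
  tags, so the step is total on numbers. Subformulas are looked up in the history \<open>h\<close>,
  whose head belongs to \<open>n - 1\<close>.\<close>

definition algebra_step :: "nat \<Rightarrow> nat \<Rightarrow> nat \<Rightarrow> nat \<Rightarrow> nat" where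
  "algebra_step q N n h =
     (if left n = 0 then first_algebra q N
        (\<lambda>l. 2 * left (right n) \<in> set_decode (right l) \<or> 2 * right (right n) \<in> set_decode (right l))
        (\<lambda>l. 2 * right (right n) \<notin> set_decode (right l))
      else if left n = 1 then first_algebra q N
        (\<lambda>l. 2 * left (right n) \<in> set_decode (right l) \<or> 2 * right (right n) \<in> set_decode (right l))
        (\<lambda>l. 2 * left (right n) \<in> set_decode (right l) \<and> 2 * right (right n) \<in> set_decode (right l))
      else if left n = 2 then first_algebra q N
        (\<lambda>l. 2 * right (right n) \<in> set_decode (right l)) (\<lambda>l. left l = left (right n))
      else if left n = 3 then first_algebra q N
        (\<lambda>l. 2 * left (right n) \<in> set_decode (right l))
        (\<lambda>l. Suc (2 * right (right n)) \<in> set_decode (right l))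
      else if left n = 4 then neg_algebra q N (lookup h (n - Suc (right n)))
      else if left n = 5 then conj_algebra q N (lookup h (n - Suc (left (right n))))
        (lookup h (n - Suc (right (right n))))
      else if left n = 6 then ex_algebra q N (2 * left (right n)) (conj_algebra q N
        (first_algebra q N (\<lambda>l. 2 * left (right n) \<in> set_decode (right l)) (\<lambda>l. True))
        (lookup h (n - Suc (right (right n)))))
      else ex_algebra q N (Suc (2 * left (right n))) (lookup h (n - Suc (right (right n)))))"

definition formula_algebra :: "nat \<Rightarrow> nat \<Rightarrow> nat \<Rightarrow> nat" where
  "formula_algebra q N n = algebra_step q N n (history (algebra_step q N) n)"

lemma lookup_history_algebra_step:
  "k < n \<Longrightarrow> lookup (history (algebra_step q N) n) (n - Suc k) = formula_algebra q N k"
  by (simp add: lookup_history formula_algebra_def)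

text \<open>Makes the recursion on codes well founded: compound formulas have tags 4 to 7, and a
  positive tag puts the code strictly above its body, so the history contains the
  subformulas.\<close>

lemma less_prod_encode: "0 < t \<Longrightarrow> r < prod_encode (t, r)"
proof -
  assume "0 < t"
  have "n \<le> triangle n" for n by (induction n) auto
  from this[of "t + r"] \<open>0 < t\<close> show ?thesis by (simp add: prod_encode_def)
qed

lemma less_prod_encode_left: "0 < t \<Longrightarrow> a < prod_encode (t, prod_encode (a, b))"
  and less_prod_encode_right: "0 < t \<Longrightarrow> b < prod_encode (t, prod_encode (a, b))"
  using less_prod_encode[of t "prod_encode (a, b)"] le_prod_encode_1[of a b]
    le_prod_encode_2[of b a] by (meson le_less_trans)+

text \<open>Names of variables are at most the code, so \<open>N\<close> exceeds every track in use.
  Codes of subformulas are smaller, which lets one \<open>N\<close> serve the whole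
  induction.\<close>

lemma recognizes_formula:
  assumes "2 * code c \<phi> + 1 < N"
  shows "recognizes q N (formula_algebra q N (code c \<phi>)) (lang c \<phi>)"
  using assms
proof (induction \<phi>)
  case (Less x y)
  show ?case unfolding formula_algebra_def algebra_step_def lang.simps
    by simp (rule recognizes_first; simp)
next
  case (Equal x y)
  show ?case unfolding formula_algebra_def algebra_step_def lang.simps
    by simp (rule recognizes_first; simp)
next
  case (Symbol s x)
  show ?case unfolding formula_algebra_def algebra_step_def lang.simps
    by simp (rule recognizes_first; simp)
next
  case (Member x X)
  show ?case unfolding formula_algebra_def algebra_step_def lang.simps
    by (simp del: set_decode_Suc) (rule recognizes_first; simp del: set_decode_Suc)
next
  case (Neg \<phi>)
  have "code c \<phi> < code c (Neg \<phi>)" by (simp add: less_prod_encode)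
  then have "formula_algebra q N (code c (Neg \<phi>)) =
      neg_algebra q N (formula_algebra q N (code c \<phi>))"
    and "2 * code c \<phi> + 1 < N"
    using Neg.prems by (simp_all add: formula_algebra_def[of q N "code c (Neg \<phi>)", unfolded code.simps]
        algebra_step_def lookup_history_algebra_step)
  with recognizes_not[OF Neg.IH] show ?case by simp
next
  case (Conj \<phi> \<psi>)
  have "code c \<phi> < code c (Conj \<phi> \<psi>)" "code c \<psi> < code c (Conj \<phi> \<psi>)"
    by (simp_all add: less_prod_encode_left less_prod_encode_right)
  then have "formula_algebra q N (code c (Conj \<phi> \<psi>)) =
      conj_algebra q N (formula_algebra q N (code c \<phi>)) (formula_algebra q N (code c \<psi>))"
    and "2 * code c \<phi> + 1 < N" "2 * code c \<psi> + 1 < N"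
    using Conj.prems by (simp_all add: formula_algebra_def[of q N "code c (Conj \<phi> \<psi>)", unfolded code.simps]
        algebra_step_def lookup_history_algebra_step)
  with recognizes_conj[OF Conj.IH] show ?case by simp
next
  case (Ex1 x \<phi>)
  have less: "x < code c (Ex1 x \<phi>)" "code c \<phi> < code c (Ex1 x \<phi>)"
    by (simp_all add: less_prod_encode_left less_prod_encode_right)
  then have eq: "formula_algebra q N (code c (Ex1 x \<phi>)) = ex_algebra q N (2 * x) (conj_algebra q N
      (first_algebra q N (\<lambda>l. 2 * x \<in> set_decode (right l)) (\<lambda>l. True))
      (formula_algebra q N (code c \<phi>)))"
    and "2 * code c \<phi> + 1 < N" "2 * x < N"
    using Ex1.prems by (simp_all add: formula_algebra_def[of q N "code c (Ex1 x \<phi>)", unfolded code.simps]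
        algebra_step_def lookup_history_algebra_step)
  moreover have "recognizes q N (first_algebra q N (\<lambda>l. 2 * x \<in> set_decode (right l)) (\<lambda>l. True))
      (lang_first (\<lambda>a. 2 * x \<in> snd a) (\<lambda>a. True))"
    by (rule recognizes_first; simp)
  ultimately show ?case
    unfolding eq lang.simps by (intro recognizes_ex recognizes_conj Ex1.IH) auto
next
  case (Ex2 X \<phi>)
  have less: "X < code c (Ex2 X \<phi>)" "code c \<phi> < code c (Ex2 X \<phi>)"
    by (simp_all add: less_prod_encode_left less_prod_encode_right)
  then have eq: "formula_algebra q N (code c (Ex2 X \<phi>)) =
      ex_algebra q N (Suc (2 * X)) (formula_algebra q N (code c \<phi>))"
    and "2 * code c \<phi> + 1 < N" "Suc (2 * X) < N"
    using Ex2.prems by (simp_all add: formula_algebra_def[of q N "code c (Ex2 X \<phi>)", unfolded code.simps]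
        algebra_step_def lookup_history_algebra_step)
  then show ?case unfolding eq lang.simps by (intro recognizes_ex Ex2.IH)
qed

section \<open>Computability of the algebra constructions\<close>

lemma computable_alg_size [computable_intros]:
  "computable A \<Longrightarrow> computable (\<lambda>x. alg_size (A x))"
  unfolding alg_size_def by (intro computable_intros)

lemma computable_alg_mult [computable_intros]:
  "computable A \<Longrightarrow> computable f \<Longrightarrow> computable g \<Longrightarrow> computable (\<lambda>x. alg_mult (A x) (f x) (g x))"
  unfolding alg_mult_def by (intro computable_intros)

lemma computable_alg_letter [computable_intros]:
  "computable A \<Longrightarrow> computable f \<Longrightarrow> computable (\<lambda>x. alg_letter (A x) (f x))"
  unfolding alg_letter_def by (intro computable_intros)

lemma decidable_alg_accept [computable_intros]:
  "computable A \<Longrightarrow> computable f \<Longrightarrow> computable g \<Longrightarrow> decidable (\<lambda>x. alg_accept (A x) (f x) (g x))"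
  unfolding alg_accept_def by (intro computable_intros)

lemma computable_algebra [computable_intros]:
  assumes "computable N" "computable m"
    and "computable (\<lambda>z. f (left z) (left (right z)) (right (right z)))"
    and "computable (\<lambda>z. g (left z) (right z))"
    and "decidable (\<lambda>z. P (left z) (left (right z)) (right (right z)))"
  shows "computable (\<lambda>x. algebra q (N x) (m x) (f x) (g x) (P x))"
  unfolding algebra_def by (intro computable_intros assms)

lemma computable_neg_algebra [computable_intros]:
  assumes "computable N" "computable A"
  shows "computable (\<lambda>x. neg_algebra q (N x) (A x))"
  unfolding neg_algebra_def
  by (intro computable_intros assms computable_compose[OF assms(2)])

lemma computable_conj_algebra [computable_intros]:
  assumes "computable N" "computable A" "computable B"
  shows "computable (\<lambda>x. conj_algebra q (N x) (A x) (B x))"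
  unfolding conj_algebra_def
  by (intro computable_intros assms computable_compose[OF assms(2)] computable_compose[OF assms(3)])

lemma computable_ex_algebra [computable_intros]:
  assumes "computable N" "computable v" "computable A"
  shows "computable (\<lambda>x. ex_algebra q (N x) (v x) (A x))"
  unfolding ex_algebra_def
  by (intro computable_intros assms computable_compose[OF assms(1)]
      computable_compose[OF assms(2)] computable_compose[OF assms(3)])

lemma computable_first_algebra [computable_intros]:
  assumes "computable N" "decidable (\<lambda>z. ev (left z) (right z))"
    "decidable (\<lambda>z. good (left z) (right z))"
  shows "computable (\<lambda>x. first_algebra q (N x) (ev x) (good x))"
  unfolding first_algebra_def by (intro computable_intros assms)

lemma computable_algebra_step [computable_intros]:
  assumes "computable N" "computable n" "computable h"
  shows "computable (\<lambda>x. algebra_step q (N x) (n x) (h x))"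
  unfolding algebra_step_def
  by (intro computable_intros assms computable_compose[OF assms(2)])

lemma computable_formula_algebra [computable_intros]:
  assumes "computable N" "computable n"
  shows "computable (\<lambda>x. formula_algebra q (N x) (n x))"
  unfolding formula_algebra_def
  by (intro computable_intros assms computable_compose[OF assms(1)])

section \<open>Words containing every finite word\<close>

text \<open>The word of a sentence carries no marks, so it can contain only words over its own
  letters. The semigroup \<open>types\<close> is restricted to these words.\<close>

locale rich_word =
  fixes q N A :: nat and \<tau> :: "letter list \<Rightarrow> nat" and w :: "nat \<Rightarrow> letter"
  assumes typing: "typing q N A \<tau>"
    and range: "range w \<subseteq> letters q N"
    and rich: "set u \<subseteq> range w \<Longrightarrow> \<exists>i. map w [i..<i + length u] = u"
begin

abbreviation mult :: "nat \<Rightarrow> nat \<Rightarrow> nat" (infixl "\<cdot>" 70) where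
  "a \<cdot> b \<equiv> alg_mult A a b"

definition types :: "nat set" where
  "types = {\<tau> u |u. u \<noteq> [] \<and> set u \<subseteq> range w}"

lemma type_in: "u \<noteq> [] \<Longrightarrow> set u \<subseteq> range w \<Longrightarrow> \<tau> u \<in> types"
  unfolding types_def by blast

lemma segment_in: "i < j \<Longrightarrow> \<tau> (map w [i..<j]) \<in> types"
  by (rule type_in) auto

lemma type_append:
  "u \<noteq> [] \<Longrightarrow> u' \<noteq> [] \<Longrightarrow> set u \<subseteq> range w \<Longrightarrow> set u' \<subseteq> range w \<Longrightarrow> \<tau> (u @ u') = \<tau> u \<cdot> \<tau> u'"
  using range by (intro typing_append[OF typing]) auto

lemma finite_types: "finite types"
proof (rule finite_subset)
  show "types \<subseteq> {..<alg_size A}"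
  proof
    fix d assume "d \<in> types"
    then obtain u where "d = \<tau> u" "u \<noteq> []" "set u \<subseteq> range w" unfolding types_def by blast
    then show "d \<in> {..<alg_size A}"
      using typing_less[OF typing, of u] range by (simp add: subset_trans)
  qed
qed simp

lemma mult_closed [simp]:
  assumes "a \<in> types" "b \<in> types"
  shows "a \<cdot> b \<in> types"
proof -
  obtain u u' where "a = \<tau> u" "b = \<tau> u'" "u \<noteq> []" "u' \<noteq> []" "set u \<subseteq> range w" "set u' \<subseteq> range w"
    using assms unfolding types_def by blast
  then show ?thesis using type_in[of "u @ u'"] by (simp add: type_append)
qed

lemma mult_assoc:
  assumes "a \<in> types" "b \<in> types" "c \<in> types"
  shows "a \<cdot> b \<cdot> c = a \<cdot> (b \<cdot> c)"
proof -
  obtain u1 u2 u3 where u: "a = \<tau> u1" "b = \<tau> u2" "c = \<tau> u3" "u1 \<noteq> []" "u2 \<noteq> []" "u3 \<noteq> []"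
    "set u1 \<subseteq> range w" "set u2 \<subseteq> range w" "set u3 \<subseteq> range w"
    using assms unfolding types_def by blast
  then have "\<tau> ((u1 @ u2) @ u3) = a \<cdot> b \<cdot> c" "\<tau> (u1 @ (u2 @ u3)) = a \<cdot> (b \<cdot> c)"
    using type_append[of "u1 @ u2" u3] type_append[of u1 "u2 @ u3"] type_append[of u1 u2]
      type_append[of u2 u3] by simp_all
  then show ?thesis by simp
qed

text \<open>Richness promises one occurrence without a position. Applied to \<open>u\<close> padded
  in front by \<open>n\<close> letters, it places \<open>u\<close> at \<open>n\<close> or
  later.\<close>

lemma occurs_beyond:
  assumes "set u \<subseteq> range w"
  obtains i where "n \<le> i" "map w [i..<i + length u] = u"
proof -
  have "set (replicate n (w 0) @ u) \<subseteq> range w"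
    using assms by (auto simp: set_replicate_conv_if)
  from rich[OF this] obtain i
    where i: "map w [i..<i + length (replicate n (w 0) @ u)] = replicate n (w 0) @ u" ..
  have "map w [i + n..<i + n + length u] = drop n (map w [i..<i + length (replicate n (w 0) @ u)])"
    by (simp add: drop_map add.assoc)
  also have "\<dots> = u" unfolding i by simp
  finally show thesis by (intro that[of "i + n"]) auto
qed

lemma linked_in_types:
  assumes "linked \<tau> w p t f"
  shows "t \<in> types" "f \<in> types"
proof -
  have "0 < p 0" "p 0 < p 1" using assms by (simp_all add: linked_def strict_mono_less)
  from segment_in[OF this(1)] segment_in[OF this(2)] show "t \<in> types" "f \<in> types"
    using assms by (simp_all add: linked_def)
qed

text \<open>A word of type \<open>g\<close> occurs strictly inside some segment between two cut
  points, and that segment has type \<open>f\<close>. So \<open>f\<close> lies in every two-sided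
  ideal generated by a type.\<close>

lemma linked_factors:
  assumes "linked \<tau> w p t f" "g \<in> types"
  obtains a b where "a \<in> types" "b \<in> types" "f = a \<cdot> (g \<cdot> b)"
proof -
  obtain z where z: "g = \<tau> z" "z \<noteq> []" "set z \<subseteq> range w"
    using assms(2) unfolding types_def by blast
  obtain i where i: "Suc (p 0) \<le> i" "map w [i..<i + length z] = z"
    using occurs_beyond[OF z(3)] .
  \<comment> \<open>\<open>p j\<close> is at least \<open>j\<close>, so it lies beyond the
    occurrence and leaves a nonempty right factor; \<open>Suc (p 0)\<close> did the same on the
    left.\<close>
  define j where "j = Suc (i + length z)"
  have p: "strict_mono p" using assms(1) by (simp add: linked_def)
  have j: "i + length z < p j"
    using strict_mono_imp_increasing[OF p, of j] by (simp add: j_def)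
  have z': "i < i + length z" using z(2) by simp
  have "f = \<tau> (map w [p 0..<p j])"
    using assms(1) by (simp add: linked_def j_def)
  also have "\<dots> = \<tau> (map w [p 0..<i]) \<cdot> \<tau> (map w [i..<p j])"
    using i j by (intro typing_segment_append[OF typing range]) auto
  also have "\<tau> (map w [i..<p j]) = g \<cdot> \<tau> (map w [i + length z..<p j])"
    using typing_segment_append[OF typing range z' j] by (simp add: i z(1))
  finally show thesis
    using i j by (intro that[OF segment_in segment_in]) auto
qed

text \<open>The right ideal \<open>e \<cdot> types\<close> is minimal.\<close>

definition minimal :: "nat \<Rightarrow> bool" where
  "minimal e \<longleftrightarrow> e \<in> types \<and> (\<forall>d\<in>types. \<exists>b\<in>types. e \<cdot> d \<cdot> b = e)"

text \<open>Let \<open>R h\<close> have least cardinality among the right ideals. By richness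
  \<open>f\<close> is a product \<open>a h b\<close>; the ideal of \<open>h b d\<close> lies in
  \<open>R h\<close>, hence equals it, so some \<open>c\<close> undoes \<open>d\<close>, and
  multiplying by \<open>a\<close> on the left carries this over to \<open>f\<close>.\<close>

lemma linked_minimal:
  assumes "linked \<tau> w p t f"
  shows "minimal f"
proof -
  define R where "R h = (\<lambda>d. h \<cdot> d) ` types" for h
  have fin: "finite (R h)" for h unfolding R_def using finite_types by simp
  have "types \<noteq> {}" using segment_in[of 0 1] by auto
  then obtain h where h: "h \<in> types" "\<And>h'. h' \<in> types \<Longrightarrow> card (R h) \<le> card (R h')"
    using ex_min_if_finite[of "(\<lambda>h. card (R h)) ` types"] finite_types
    by (metis (no_types, lifting) arg_min_if_finite(1) arg_min_least)
  obtain a b where ab: "a \<in> types" "b \<in> types" "f = a \<cdot> (h \<cdot> b)"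
    using linked_factors[OF assms h(1)] .
  have "\<exists>c\<in>types. f \<cdot> d \<cdot> c = f" if d: "d \<in> types" for d
  proof -
    have "R (h \<cdot> (b \<cdot> d)) \<subseteq> R h"
      using h(1) ab d by (auto simp: R_def mult_assoc)
    moreover have "card (R h) \<le> card (R (h \<cdot> (b \<cdot> d)))"
      using h ab d by simp
    ultimately have "R (h \<cdot> (b \<cdot> d)) = R h"
      using fin by (intro card_seteq) auto
    then have "h \<cdot> b \<in> R (h \<cdot> (b \<cdot> d))" using ab(2) by (simp add: R_def)
    then obtain c where c: "c \<in> types" "h \<cdot> b = h \<cdot> (b \<cdot> d) \<cdot> c"
      unfolding R_def by blast
    have "f \<cdot> d \<cdot> c = a \<cdot> (h \<cdot> (b \<cdot> d) \<cdot> c)"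
      using ab h(1) d c(1) by (simp add: mult_assoc)
    then show ?thesis using c ab(3) by (metis)
  qed
  then show ?thesis
    unfolding minimal_def using linked_in_types[OF assms] by blast
qed

text \<open>
  Green's relations: \<open>(s, e)\<close> and the linked pair \<open>(t, f)\<close> of \<open>w\<close> are conjugate, so that a word
  \<open>u (x y) (x y) \<dots> = (u x) (y x) (y x) \<dots>\<close> realises both of them.
\<close>

lemma conjugate:
  assumes e: "minimal e" "e \<cdot> e = e" and f: "minimal f" "f \<cdot> f = f"
    and st: "s \<in> types" "s \<cdot> e = s" "r \<in> types" "s \<cdot> r \<cdot> f = s \<cdot> r"
  obtains x y where "x \<in> types" "y \<in> types" "x \<cdot> y = e" "y \<cdot> x = f" "s \<cdot> x = s \<cdot> r"
proof -
  have in_types: "e \<in> types" "f \<in> types" using e f by (simp_all add: minimal_def)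
  \<comment> \<open>Sandwiching \<open>r\<close> between the idempotents gives
    \<open>e x = x\<close> and \<open>x f = x\<close>; minimality of \<open>e\<close> then provides
    a right factor leading back from \<open>x\<close> to \<open>e\<close>.\<close>
  define x where "x = e \<cdot> (r \<cdot> f)"
  obtain b where b: "b \<in> types" "x \<cdot> b = e"
    using e(1) st(3) in_types unfolding minimal_def x_def by (meson mult_closed)
  define y where "y = f \<cdot> (b \<cdot> e)"
  have xy_in: "x \<in> types" "y \<in> types" using in_types st b by (simp_all add: x_def y_def)
  have xf: "x \<cdot> f = x" using in_types st f by (simp add: x_def mult_assoc)
  have ex: "e \<cdot> x = x"
    using in_types st e mult_assoc[of e e "r \<cdot> f"] by (simp add: x_def)
  have ye: "y \<cdot> e = y" using in_types b e by (simp add: y_def mult_assoc)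
  have xy: "x \<cdot> y = e"
  proof -
    have "x \<cdot> y = x \<cdot> f \<cdot> (b \<cdot> e)" using in_types xy_in b by (simp add: y_def mult_assoc)
    also have "\<dots> = x \<cdot> b \<cdot> e" using mult_assoc[of x b e] in_types xy_in b by (simp add: xf)
    finally show ?thesis using b e by simp
  qed
  have idem: "y \<cdot> x \<cdot> (y \<cdot> x) = y \<cdot> x"
  proof -
    have "y \<cdot> x \<cdot> (y \<cdot> x) = y \<cdot> (x \<cdot> y) \<cdot> x" using xy_in by (simp add: mult_assoc)
    then show ?thesis by (simp add: xy ye)
  qed
  have "y \<cdot> x = f \<cdot> (b \<cdot> e \<cdot> x)" using in_types b xy_in by (simp add: y_def mult_assoc)
  moreover have "b \<cdot> e \<cdot> x \<in> types" using in_types b xy_in by simp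
  ultimately obtain c where c: "c \<in> types" "y \<cdot> x \<cdot> c = f"
    using f(1) unfolding minimal_def by metis
  \<comment> \<open>The idempotent \<open>y x\<close> absorbs \<open>f\<close> on its right, yet
    \<open>y x f = y x y x c = y x c = f\<close>.\<close>
  have "y \<cdot> x \<cdot> f = y \<cdot> x \<cdot> (y \<cdot> x) \<cdot> c"
    using xy_in c mult_assoc[of "y \<cdot> x" "y \<cdot> x" c] by simp
  moreover have "y \<cdot> x \<cdot> f = y \<cdot> x" using xy_in in_types xf by (simp add: mult_assoc)
  ultimately have yx: "y \<cdot> x = f" using idem c by simp
  have "s \<cdot> x = s \<cdot> r"
    using mult_assoc[of s e "r \<cdot> f"] mult_assoc[of s r f] st in_types by (simp add: x_def)
  with xy_in xy yx show thesis by (rule that)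
qed

text \<open>\<open>(s, e)\<close> need not come from a factorization of \<open>w\<close>, as
  \<open>e\<close> is just the type of some factor. The word \<open>v = P X Y X Y ...\<close> is
  linked to it and also to a Ramsey pair \<open>(t, f)\<close> of \<open>w\<close>; so the two table
  entries agree, and the second one decides \<open>L w\<close>.\<close>

lemma accept_iff:
  assumes L: "\<And>x p s e. range x \<subseteq> letters q N \<Longrightarrow> linked \<tau> x p s e \<Longrightarrow> alg_accept A s e \<longleftrightarrow> L x"
    and e: "minimal e" "e \<cdot> e = e"
    and s: "0 < n" "s = \<tau> (map w [0..<n])" "s \<cdot> e = s"
  shows "alg_accept A s e \<longleftrightarrow> L w"
proof -
  have "strict_mono (\<lambda>i::nat. i)" by (simp add: strict_mono_def)
  then obtain p t f where lk: "linked \<tau> w p t f"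
    using linked_subsequence_exists[OF typing range] by metis
  have p: "strict_mono p" using lk by (simp add: linked_def)
  have n: "n < p (Suc n)" using strict_mono_imp_increasing[OF p, of "Suc n"] by simp
  define r where "r = \<tau> (map w [n..<p (Suc n)])"
  have t: "t = s \<cdot> r"
    using typing_segment_append[OF typing range s(1) n] lk by (simp add: s(2) r_def linked_def)
  note ff = linked_idempotent[OF typing range lk]
  obtain x y where xy: "x \<in> types" "y \<in> types" "x \<cdot> y = e" "y \<cdot> x = f" "s \<cdot> x = t"
  proof (rule conjugate[OF e linked_minimal[OF lk] ff(1), of s r])
    show "s \<in> types" "r \<in> types" using s(1,2) n by (auto simp: r_def segment_in)
    show "s \<cdot> e = s" by (rule s(3))
    show "s \<cdot> r \<cdot> f = s \<cdot> r" using ff(2) t by simp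
  qed (use that t in simp)
  obtain X where X: "x = \<tau> X" "X \<noteq> []" "set X \<subseteq> range w" using xy(1) unfolding types_def by blast
  obtain Y where Y: "y = \<tau> Y" "Y \<noteq> []" "set Y \<subseteq> range w" using xy(2) unfolding types_def by blast
  define P where "P = map w [0..<n]"
  have P: "s = \<tau> P" "P \<noteq> []" "set P \<subseteq> range w" using s by (auto simp: P_def)
  define u where "u i = (if i = 0 then P else if odd i then X else Y)" for i :: nat
  define c where "c i = (\<Sum>j<i. length (u j))" for i
  have u: "u i \<noteq> []" "set (u i) \<subseteq> range w" for i using P X Y by (simp_all add: u_def)
  have c: "strict_mono c" "c 0 = 0"
    using u by (simp_all add: c_def strict_mono_Suc_iff)
  have len: "length (u i) = c (Suc i) - c i" for i by (simp add: c_def)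
  obtain v where v: "\<And>i. map v [c i..<c (Suc i)] = u i"
    using glue_blocks[of c u, OF c len] by blast
  have "v k \<in> range w" for k
  proof -
    obtain i where "c i \<le> k" "k < c (Suc i)" using exists_block[OF c] by blast
    then have "v k \<in> set (map v [c i..<c (Suc i)])" by simp
    then show ?thesis unfolding v using u by blast
  qed
  then have v_range: "range v \<subseteq> letters q N" using range by blast
  have pair: "map v [c i..<c (Suc (Suc i))] = u i @ u (Suc i)" for i
    unfolding v[symmetric] using c(1) by (intro map_upt_append[symmetric]) (simp_all add: strict_mono_less_eq)
  \<comment> \<open>Cuts in front of each \<open>X\<close>: the prefix is \<open>P\<close> and the
    period is \<open>X Y\<close>.\<close>
  have "linked \<tau> v (\<lambda>i. c (2 * i + 1)) s e"
  proof (rule linkedI[OF typing v_range])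
    show "strict_mono (\<lambda>i. c (2 * i + 1))" "0 < c (2 * 0 + 1)"
      using c strict_mono_less[OF c(1), of 0 1] by (simp_all add: strict_mono_def)
    show "\<tau> (map v [0..<c (2 * 0 + 1)]) = s" using v[of 0] c(2) P(1) by (simp add: u_def)
    show "\<tau> (map v [c (2 * i + 1)..<c (2 * Suc i + 1)]) = e" for i
      using pair[of "2 * i + 1"] type_append[of X Y] X Y xy(3) by (simp add: u_def)
  qed (use e s in auto)
  \<comment> \<open>Cuts behind each \<open>X\<close>: the prefix is \<open>P X\<close> and the
    period is \<open>Y X\<close>.\<close>
  moreover have "linked \<tau> v (\<lambda>i. c (2 * i + 2)) t f"
  proof (rule linkedI[OF typing v_range])
    show "strict_mono (\<lambda>i. c (2 * i + 2))" "0 < c (2 * 0 + 2)"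
      using c strict_mono_less[OF c(1), of 0 "Suc (Suc 0)"] by (simp_all add: strict_mono_def)
    show "\<tau> (map v [0..<c (2 * 0 + 2)]) = t"
      using pair[of 0] c(2) P X type_append[of P X] xy(5) by (simp add: u_def numeral_2_eq_2)
    show "\<tau> (map v [c (2 * i + 2)..<c (2 * Suc i + 2)]) = f" for i
      using pair[of "2 * i + 2"] type_append[of Y X] X Y xy(4) by (simp add: u_def)
  qed (use ff in auto)
  ultimately show ?thesis using L[OF v_range] L[OF range lk] by blast
qed

end

text \<open>The type of the factor at the positions \<open>i, \<dots>, i + k\<close>.\<close>

definition factor_type :: "(nat \<Rightarrow> nat) \<Rightarrow> nat \<Rightarrow> nat \<Rightarrow> nat \<Rightarrow> nat" where
  "factor_type v A i k = rec_nat (alg_letter A (prod_encode (v i, 0)))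
     (\<lambda>n y. alg_mult A y (alg_letter A (prod_encode (v (i + Suc n), 0)))) k"

lemma computable_factor_type:
  assumes "computable v" "computable A" "computable i" "computable k"
  shows "computable (\<lambda>x. factor_type v (A x) (i x) (k x))"
  unfolding factor_type_def
  by (intro computable_intros assms computable_compose[OF assms(1)] computable_compose[OF assms(2)]
      computable_compose[OF assms(3)])

definition is_type :: "(nat \<Rightarrow> nat) \<Rightarrow> nat \<Rightarrow> nat \<Rightarrow> nat \<Rightarrow> bool" where
  "is_type v A M d \<longleftrightarrow> (\<exists>i<M. \<exists>k<M. factor_type v A i k = d)"

lemma decidable_is_type:
  assumes "computable v" "computable A" "computable M" "computable d"
  shows "decidable (\<lambda>x. is_type v (A x) (M x) (d x))"
  unfolding is_type_def
  by (intro computable_intros computable_factor_type assms computable_compose[OF assms(2)]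
      computable_compose[OF assms(3)] computable_compose[OF assms(4)])

text \<open>
  The first two conditions say that all types of finite words occur within the bound \<open>M\<close>; hence
  the quantifiers of the last one range over all types.
\<close>

definition certificate :: "(nat \<Rightarrow> nat) \<Rightarrow> nat \<Rightarrow> nat \<Rightarrow> nat \<Rightarrow> nat \<Rightarrow> nat \<Rightarrow> nat \<Rightarrow> nat \<Rightarrow> bool" where
  "certificate v q C A M n i k \<longleftrightarrow>
     (\<forall>a<q. a \<in> set_decode C \<longrightarrow> is_type v A M (alg_letter A (prod_encode (a, 0)))) \<and>
     (\<forall>i'<M. \<forall>k'<M. \<forall>a<q. a \<in> set_decode C \<longrightarrow>
        is_type v A M (alg_mult A (factor_type v A i' k') (alg_letter A (prod_encode (a, 0))))) \<and>
     alg_mult A (factor_type v A i k) (factor_type v A i k) = factor_type v A i k \<and>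
     alg_mult A (factor_type v A 0 n) (factor_type v A i k) = factor_type v A 0 n \<and>
     (\<forall>i'<M. \<forall>k'<M. \<exists>i''<M. \<exists>k''<M. alg_mult A (alg_mult A (factor_type v A i k)
        (factor_type v A i' k')) (factor_type v A i'' k'') = factor_type v A i k)"

lemma decidable_certificate:
  assumes "computable v" "computable A" "computable M" "computable n" "computable i" "computable k"
  shows "decidable (\<lambda>x. certificate v q C (A x) (M x) (n x) (i x) (k x))"
  unfolding certificate_def
  by (intro computable_intros computable_factor_type decidable_is_type assms
      computable_compose[OF assms(2)] computable_compose[OF assms(3)] computable_compose[OF assms(4)]
      computable_compose[OF assms(5)] computable_compose[OF assms(6)])

section \<open>Soundness and existence of certificates\<close>

context rich_word
begin

context
  fixes v :: "nat \<Rightarrow> nat" and C :: nat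
  assumes v: "\<And>i. w i = (v i, {})" and C: "{a. a < q \<and> a \<in> set_decode C} = range v"
begin

text \<open>Since \<open>set_encode {} = 0\<close>, the number \<open>prod_encode (a, 0)\<close>
  codes the unmarked letter with symbol \<open>a\<close>.\<close>

lemma letter_value: "alg_letter A (prod_encode (v i, 0)) = \<tau> [w i]"
proof -
  have "w i \<in> letters q N" using range by blast
  from typing_letter[OF typing this] show ?thesis by (simp add: v code_letter_def)
qed

lemma factor_type_eq: "factor_type v A i k = \<tau> (map w [i..<Suc (i + k)])"
proof (induction k)
  case (Suc k)
  then show ?case
    using typing_segment_append[OF typing range, of i "Suc (i + k)" "Suc (i + Suc k)"]
    by (simp add: factor_type_def letter_value)
qed (simp add: factor_type_def letter_value)

lemma factor_type_in: "factor_type v A i k \<in> types"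
  unfolding factor_type_eq by (rule segment_in) simp

text \<open>Every nonempty word arises from a letter by appending letters, so a set of types that
  contains those of the letters and is closed under this operation is complete.\<close>

lemma types_eq:
  assumes "\<And>a. a < q \<Longrightarrow> a \<in> set_decode C \<Longrightarrow> is_type v A M (alg_letter A (prod_encode (a, 0)))"
    and "\<And>d a. is_type v A M d \<Longrightarrow> a < q \<Longrightarrow> a \<in> set_decode C \<Longrightarrow>
      is_type v A M (alg_mult A d (alg_letter A (prod_encode (a, 0))))"
  shows "is_type v A M d \<longleftrightarrow> d \<in> types"
proof
  assume "is_type v A M d"
  then show "d \<in> types" using factor_type_in by (auto simp: is_type_def)
next
  assume "d \<in> types"
  then obtain u where u: "d = \<tau> u" "u \<noteq> []" "set u \<subseteq> range w" unfolding types_def by blast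
  have letter: "\<exists>a<q. a \<in> set_decode C \<and> \<tau> [l] = alg_letter A (prod_encode (a, 0))"
    if "l \<in> range w" for l
  proof -
    from that obtain i where "l = w i" by blast
    moreover have "v i < q \<and> v i \<in> set_decode C" using C by blast
    ultimately show ?thesis using letter_value[of i] by auto
  qed
  have "u \<noteq> [] \<Longrightarrow> set u \<subseteq> range w \<Longrightarrow> is_type v A M (\<tau> u)"
  proof (induction u rule: rev_induct)
    case (snoc l u)
    then obtain a where a: "a < q" "a \<in> set_decode C" "\<tau> [l] = alg_letter A (prod_encode (a, 0))"
      using letter[of l] by auto
    show ?case
    proof (cases "u = []")
      case True
      then show ?thesis using assms(1)[OF a(1,2)] a(3) by simp
    next
      case False
      then have "\<tau> (u @ [l]) = alg_mult A (\<tau> u) (\<tau> [l])"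
        using snoc.prems by (intro type_append) auto
      then show ?thesis using assms(2)[OF _ a(1,2)] snoc False a(3) by simp
    qed
  qed simp
  then show "is_type v A M d" using u by simp
qed

text \<open>By \<open>types_eq\<close> the bounded quantifiers range over all types, which turns the
  last condition into minimality.\<close>

lemma certificate_sound:
  assumes "certificate v q C A M n i k"
    and L: "\<And>x p s e. range x \<subseteq> letters q N \<Longrightarrow> linked \<tau> x p s e \<Longrightarrow> alg_accept A s e \<longleftrightarrow> L x"
  shows "alg_accept A (factor_type v A 0 n) (factor_type v A i k) \<longleftrightarrow> L w"
proof -
  have types: "is_type v A M d \<longleftrightarrow> d \<in> types" for d
  proof (rule types_eq)
    show "is_type v A M (alg_letter A (prod_encode (a, 0)))" if "a < q" "a \<in> set_decode C" for a
      using assms(1) that unfolding certificate_def by blast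
    show "is_type v A M (alg_mult A d (alg_letter A (prod_encode (a, 0))))"
      if "is_type v A M d" "a < q" "a \<in> set_decode C" for d a
    proof -
      from that(1) obtain i' k' where "i' < M" "k' < M" "d = factor_type v A i' k'"
        unfolding is_type_def by blast
      with assms(1) that(2,3) show ?thesis unfolding certificate_def by blast
    qed
  qed
  have "\<exists>b\<in>types. factor_type v A i k \<cdot> d \<cdot> b = factor_type v A i k" if d: "d \<in> types" for d
  proof -
    from d obtain i' k' where ik: "i' < M" "k' < M" "d = factor_type v A i' k'"
      unfolding types[symmetric] is_type_def by blast
    then have "\<exists>i''<M. \<exists>k''<M. factor_type v A i k \<cdot> d \<cdot> factor_type v A i'' k'' = factor_type v A i k"
      using assms(1) unfolding certificate_def by blast
    then show ?thesis using factor_type_in by blast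
  qed
  then have "minimal (factor_type v A i k)" by (simp add: minimal_def factor_type_in)
  \<comment> \<open>\<open>factor_type v A 0 n\<close> is the type of the prefix of length
    \<open>Suc n\<close>.\<close>
  then show ?thesis
    using assms(1) factor_type_eq[of 0 n]
    by (intro accept_iff[OF L, where n = "Suc n"]) (simp_all add: certificate_def)
qed

text \<open>There are finitely many types and each occurs in \<open>w\<close>, so some bound covers
  them all; a Ramsey factorization of \<open>w\<close> itself supplies the pair.\<close>

lemma certificate_exists: "\<exists>M n i k. certificate v q C A M n i k"
proof -
  have "strict_mono (\<lambda>i::nat. i)" by (simp add: strict_mono_def)
  then obtain p s e where lk: "linked \<tau> w p s e"
    using linked_subsequence_exists[OF typing range] by metis
  have occ: "\<exists>i k. factor_type v A i k = d" if d: "d \<in> types" for d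
  proof -
    obtain u where u: "d = \<tau> u" "u \<noteq> []" "set u \<subseteq> range w" using d unfolding types_def by blast
    then obtain i where "map w [i..<i + length u] = u" using rich by blast
    moreover have "Suc (i + (length u - 1)) = i + length u" using u(2) by (cases u) simp_all
    ultimately have "factor_type v A i (length u - 1) = d" by (simp only: factor_type_eq u(1))
    then show ?thesis by blast
  qed
  then obtain fi fk where f: "\<And>d. d \<in> types \<Longrightarrow> factor_type v A (fi d) (fk d) = d" by metis
  \<comment> \<open>Covers one occurrence of every type; the positions \<open>i\<close>,
    \<open>k\<close> and \<open>n\<close> may lie beyond it.\<close>
  define M where "M = Suc (Max (fi ` types \<union> fk ` types))"
  have "fi d < M" "fk d < M" if "d \<in> types" for d
    using that finite_types unfolding M_def by (auto intro!: le_imp_less_Suc Max_ge)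
  then have M: "is_type v A M d" if "d \<in> types" for d
    using that f unfolding is_type_def by blast
  have letter_in: "alg_letter A (prod_encode (a, 0)) \<in> types" if "a < q" "a \<in> set_decode C" for a
  proof -
    have "a \<in> range v" using that C by blast
    then show ?thesis using letter_value type_in[of "[w _]"] by auto
  qed
  have min: "minimal e" by (rule linked_minimal[OF lk])
  obtain i k where e: "factor_type v A i k = e"
    using occ min unfolding minimal_def by blast
  \<comment> \<open>The prefix up to \<open>p 0\<close> is nonempty and
    \<open>factor_type v A 0 n\<close> reads one letter more than \<open>n\<close>.\<close>
  define n where "n = p 0 - 1"
  have s: "factor_type v A 0 n = s"
    using lk by (simp add: linked_def factor_type_eq n_def)
  have "\<exists>i''<M. \<exists>k''<M. e \<cdot> factor_type v A i' k' \<cdot> factor_type v A i'' k'' = e" for i' k'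
  proof -
    obtain b where b: "b \<in> types" "e \<cdot> factor_type v A i' k' \<cdot> b = e"
      using min factor_type_in unfolding minimal_def by blast
    with M[OF b(1)] show ?thesis unfolding is_type_def by blast
  qed
  then have "certificate v q C A M n i k"
    unfolding certificate_def e s
    using linked_idempotent[OF typing range lk] M letter_in factor_type_in mult_closed by simp
  then show ?thesis by blast
qed

end

end

section \<open>One search program for all sentences\<close>

theorem corollary1:
  fixes W :: "nat \<Rightarrow> 'a::finite"
  assumes "computable_word W"
    and "\<forall>u :: 'a list. factor u W"
  shows "decidable_theory (MT W)"
  unfolding decidable_theory_def
proof (intro allI impI)
  fix c :: "'a \<Rightarrow> nat"
  assume c: "inj c"
  define v where "v = (\<lambda>i. c (W i))"
  obtain c\<^sub>0 :: "'a \<Rightarrow> nat" where "inj c\<^sub>0" "computable (\<lambda>n. c\<^sub>0 (W n))"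
    using assms(1) unfolding computable_word_def by blast
  \<comment> \<open>\<open>W\<close> is computable in the numbering \<open>c\<^sub>0\<close>, but
    decidability concerns an arbitrary \<open>c\<close>; finiteness of the alphabet bridges the
    two.\<close>
  then have v: "computable v"
    unfolding v_def by (intro computable_finite_function[of UNIV c\<^sub>0 W c]) simp_all
  define w :: "nat \<Rightarrow> letter" where "w = (\<lambda>i. (v i, {}))"
  have w: "w i = (v i, {})" for i by (simp add: w_def)
  define q where "q = Suc (Max (range c))"
  define C where "C = set_encode (range c)"
  define A where "A = (\<lambda>n. formula_algebra q (2 * n + 2) n)"
  have "computable A" unfolding A_def by (intro computable_intros)
  note A = computable_compose[OF this]
  have cq: "c a < q" for a
    unfolding q_def by (intro le_imp_less_Suc Max_ge) auto
  \<comment> \<open>One-letter words are factors too, so every symbol occurs and \<open>C\<close>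
    codes exactly the symbols of \<open>w\<close>.\<close>
  have W_surj: "a \<in> range W" for a
  proof -
    obtain n m where "[a] = map W [n..<Suc m]"
      using assms(2)[rule_format, of "[a]"] unfolding factor_def by (metis list.distinct(1))
    then have "a \<in> set (map W [n..<Suc m])" by (metis list.set_intros(1))
    then show ?thesis by auto
  qed
  have "range v = c ` range W" by (simp add: v_def image_image)
  also have "range W = UNIV" using W_surj by blast
  finally have "range v = range c" .
  moreover have "{a. a < q \<and> a \<in> range c} = range c" using cq by blast
  ultimately have C: "{a. a < q \<and> a \<in> set_decode C} = range v" by (simp add: C_def)
  have rich: "\<exists>i. map w [i..<i + length u] = u" if u: "set u \<subseteq> range w" for u
  proof (cases "u = []")
    case False
    have "\<forall>l\<in>set u. \<exists>a. l = (c a, {})" using u unfolding w_def v_def by blast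
    then have "\<exists>u'. u = map (\<lambda>a. (c a, {})) u'" by (simp only: ex_map_conv)
    then obtain u' where u': "u = map (\<lambda>a. (c a, {})) u'" ..
    with False have "u' \<noteq> []" by simp
    then obtain n m where nm: "n \<le> m" "u' = map W [n..<Suc m]"
      using assms(2)[rule_format, of u'] unfolding factor_def by metis
    then have "length u = Suc m - n" "map w [n..<Suc m] = u"
      by (simp_all add: u' w_def v_def comp_def)
    with nm(1) show ?thesis by (intro exI[of _ n]) simp
  qed simp
  let ?M = left and ?n = "\<lambda>z. left (right z)" and ?i = "\<lambda>z. left (right (right z))"
    and ?k = "\<lambda>z. right (right (right z))"
  let ?P = "\<lambda>x z. certificate v q C (A x) (?M z) (?n z) (?i z) (?k z)"
  let ?f = "\<lambda>x z. of_bool (alg_accept (A x) (factor_type v (A x) 0 (?n z))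
    (factor_type v (A x) (?i z) (?k z)))"
  \<comment> \<open>The search is set up on codes before any sentence is given. Its candidates
    \<open>z\<close> pack \<open>M\<close>, \<open>n\<close>, \<open>i\<close> and
    \<open>k\<close>.\<close>
  have "\<exists>p. \<forall>x b. (\<exists>z. ?P x z) \<longrightarrow> (\<forall>z. ?P x z \<longrightarrow> ?f x z = b) \<longrightarrow> evaluates p [x] b"
  proof (rule evaluates_search)
    show "decidable (\<lambda>z. ?P (left z) (right z))"
      by (intro decidable_certificate v computable_intros A)
    show "computable (\<lambda>z. ?f (left z) (right z))"
      by (intro computable_intros computable_factor_type v A)
  qed
  then obtain p where p: "\<And>x b. \<exists>z. ?P x z \<Longrightarrow> (\<forall>z. ?P x z \<longrightarrow> ?f x z = b) \<Longrightarrow> evaluates p [x] b"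
    by blast
  have "evaluates p [code c \<phi>] (if \<phi> \<in> MT W then 1 else 0)" if \<phi>: "sentence \<phi>" for \<phi>
  proof -
    let ?x = "code c \<phi>"
    \<comment> \<open>The left side mentions no assignment, so truth under one is truth under all,
      as membership in \<open>MT W\<close> requires.\<close>
    have "lang c \<phi> w \<longleftrightarrow> sat W e E \<phi>" for e E
      by (rule lang_iff_sat[OF c]) (use \<phi> in \<open>auto simp: w_def v_def sentence_def\<close>)
    then have L: "lang c \<phi> w \<longleftrightarrow> \<phi> \<in> MT W" using \<phi> by (simp add: MT_def)
    have "recognizes q (2 * ?x + 2) (A ?x) (lang c \<phi>)"
      unfolding A_def by (rule recognizes_formula) simp
    then obtain \<tau> where ty: "typing q (2 * ?x + 2) (A ?x) \<tau>" and
      acc: "\<And>x p s e. range x \<subseteq> letters q (2 * ?x + 2) \<Longrightarrow> linked \<tau> x p s e \<Longrightarrow>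
        alg_accept (A ?x) s e \<longleftrightarrow> lang c \<phi> x"
      unfolding recognizes_def by blast
    interpret rich_word q "2 * ?x + 2" "A ?x" \<tau> w
    proof
      show "range w \<subseteq> letters q (2 * ?x + 2)" using cq by (auto simp: w_def v_def mem_letters_iff)
    qed (use ty rich in blast)+
    show ?thesis
    proof (rule p)
      obtain M n i k where "certificate v q C (A ?x) M n i k"
        using certificate_exists[OF w C] by blast
      then show "\<exists>z. ?P ?x z"
        by (intro exI[of _ "prod_encode (M, prod_encode (n, prod_encode (i, k)))"]) simp
    next
      have "?f ?x z = (if \<phi> \<in> MT W then 1 else 0)" if "?P ?x z" for z
        using certificate_sound[OF w C that acc] by (simp add: L)
      then show "\<forall>z. ?P ?x z \<longrightarrow> ?f ?x z = (if \<phi> \<in> MT W then 1 else 0)" by blast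
    qed
  qed
  then show "\<exists>p. \<forall>\<phi>. sentence \<phi> \<longrightarrow> evaluates p [code c \<phi>] (if \<phi> \<in> MT W then 1 else 0)"
    by blast
qed

end
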